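(* Let $\mathbf{X}=\mathbf{S}+\mathbf{N}$, with $\mathbf{N}$ and $\mathbf{S}$ independent, and let $\mathbf{Y}_M$ be obtained from $\mathbf{X}$ by performing dimensionality-reducing PCA. If $\mathbf{N}$ is iid (i.e., its covariance matrix $C_{\mathbf N}$ is a scaled identity matrix) and more Gaussian than $\mathbf{Y}$ in the sense $$J(\tilde{\mathbf N}_c|\tilde{\mathbf N}_M)\le J(\mathbf{Y}_c|\mathbf{Y}_M),$$ then the PCA minimizes the Gaussian upper bound on the relevant information loss $L_{\mathbf S}(\mathbf{X}\to\mathbf{Y}_M)$.
   Context: Signal model: $\mathbf{X}$ is an $N$-dimensional continuous-valued random vector, $\mathbf{S}$ is the relevant information and $\mathbf{N}$ the noise, with covariance matrices $C_{\mathbf X}$, $C_{\mathbf S}$, $C_{\mathbf N}$, respectively. PCA: $W$ is the orthogonal matrix ($W^{-1}=W^T$, $\det W=1$) of eigenvectors of $C_{\mathbf X}$, ordered such that the eigenvalues satisfy $\lambda_1\ge\lambda_2\ge\dots\ge\lambda_N$. Put $\mathbf{Y}=W^T\mathbf{X}$ and $\tilde{\mathbf N}=W^T\mathbf{N}$. For these vectors the subscript $M$ denotes the vector of the first $M$ elements and the subscript $c$ the vector of the last $N-M$ elements. Dimensionality-reducing PCA is the map $\mathbf{X}\mapsto\mathbf{Y}_M$ with $M<N$. Relevant information loss: for a random variable $X$, a static function $g$ with $Y=g(X)$, and a random variable $S$ representing relevant information, $L_S(X\to Y)=\sup_{\mathcal P}\big(I(\hat S;X)-I(\hat S;Y)\big)=I(X;S|Y)$,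 where the supremum is over all partitions $\mathcal P$ of the sample space of $S$ and $\hat S$ is obtained by quantizing $S$ accordingly. Conditional divergence: for continuous random variables $A$ and $B$ with arbitrary continuous (joint) distribution, let $A_G$ and $B_G$ be Gaussian random variables with the same (joint) first and second moments. Then $J(A|B)=h(A_G|B_G)-h(A|B)$, where $h(\cdot|\cdot)$ denotes conditional differential entropy. The phrase "Gaussian upper bound" refers to the upper bound on $L_{\mathbf S}(\mathbf{X}\to\mathbf{Y}_M)$ obtained by replacing the random vectors in $L_{\mathbf S}(\mathbf{X}\to\mathbf{Y}_M)=h(\mathbf{Y}_c|\mathbf{Y}_M)-h(\tilde{\mathbf N}_c|\tilde{\mathbf N}_M)$ by Gaussian ones with the same moments, i.e. $h(\mathbf{Y}_{c,G}|\mathbf{Y}_{M,G})-h(\tilde{\mathbf N}_{c,G}|\tilde{\mathbf N}_{M,G})$. *)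

theory Defs
  imports "HOL-Probability.Probability"
begin

text \<open>
  The \<open>N\<close> coordinates are indexed by the sum type \<open>'m + 'c\<close>: the \<open>Inl\<close> part is the block of the
  first \<open>M = CARD('m)\<close> coordinates and the \<open>Inr\<close> part the block of the last \<open>N - M = CARD('c)\<close> ones.
  Both index types are nonempty, so \<open>1 \<le> M < N\<close>.
\<close>

definition first_block :: "real ^ ('m::finite + 'c::finite) \<Rightarrow> real ^ 'm" where
  "first_block v = (\<chi> i. v $ Inl i)"

definition last_block :: "real ^ ('m::finite + 'c::finite) \<Rightarrow> real ^ 'c" where
  "last_block v = (\<chi> j. v $ Inr j)"

definition join_blocks :: "real ^ 'm \<Rightarrow> real ^ 'c \<Rightarrow> real ^ ('m::finite + 'c::finite)" where
  "join_blocks u v = (\<chi> k. case k of Inl i \<Rightarrow> u $ i | Inr j \<Rightarrow> v $ j)"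

fun coord_le :: "'m::linorder + 'c::linorder \<Rightarrow> 'm + 'c \<Rightarrow> bool" where
  "coord_le (Inl i) (Inl j) \<longleftrightarrow> i \<le> j"
| "coord_le (Inl i) (Inr j) \<longleftrightarrow> True"
| "coord_le (Inr i) (Inl j) \<longleftrightarrow> False"
| "coord_le (Inr i) (Inr j) \<longleftrightarrow> i \<le> j"

definition mean_vector :: "'a measure \<Rightarrow> ('a \<Rightarrow> real ^ 'n) \<Rightarrow> real ^ 'n" where
  "mean_vector P X = (\<chi> i. \<integral>\<omega>. X \<omega> $ i \<partial>P)"

definition cov_matrix :: "'a measure \<Rightarrow> ('a \<Rightarrow> real ^ 'n) \<Rightarrow> real ^ 'n ^ 'n" where
  "cov_matrix P X =
     (\<chi> i j. \<integral>\<omega>. (X \<omega> $ i - mean_vector P X $ i) * (X \<omega> $ j - mean_vector P X $ j) \<partial>P)"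

definition pca_matrix ::
    "real ^ ('m::{finite,linorder} + 'c::{finite,linorder}) ^ ('m + 'c) \<Rightarrow> real ^ ('m + 'c) ^ ('m + 'c) \<Rightarrow> bool" where
  "pca_matrix C W \<longleftrightarrow> rotation_matrix W \<and>
     (\<exists>ev. (\<forall>i. C *v column i W = ev i *\<^sub>R column i W) \<and>
          (\<forall>i j. coord_le i j \<longrightarrow> ev j \<le> ev i))"

text \<open>
  The law of a Gaussian vector with mean \<open>\<mu>\<close> and (positive definite) covariance matrix \<open>C\<close>. The
  covariance matrix of a vector with a Lebesgue density is never singular, so degenerate Gaussian
  laws are not needed.
\<close>

definition gaussian_measure :: "real ^ 'n \<Rightarrow> real ^ 'n ^ 'n \<Rightarrow> (real ^ 'n) measure" where
  "gaussian_measure \<mu> C = density lborel (\<lambda>x.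
     ennreal (exp (- ((x - \<mu>) \<bullet> (matrix_inv C *v (x - \<mu>))) / 2) / sqrt ((2 * pi) ^ CARD('n) * det C)))"

abbreviation cond_diff_entropy ::
    "real \<Rightarrow> 'a measure \<Rightarrow> ('a \<Rightarrow> real ^ 'c) \<Rightarrow> ('a \<Rightarrow> real ^ 'm) \<Rightarrow> real" where
  "cond_diff_entropy b P A B \<equiv> prob_space.conditional_entropy P b lborel lborel A B"

text \<open>
  The Bochner integral in the library's conditional entropy is \<open>0\<close> for a nonintegrable integrand;
  the following predicate says that \<open>h(A|B)\<close> genuinely exists and is finite: \<open>A\<close> and \<open>B\<close> have a joint
  density and the integrand of \<open>conditional_entropy\<close> is integrable.
\<close>

definition cond_diff_entropy_finite ::
    "real \<Rightarrow> 'a measure \<Rightarrow> ('a \<Rightarrow> real ^ 'c) \<Rightarrow> ('a \<Rightarrow> real ^ 'm) \<Rightarrow> bool" where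
  "cond_diff_entropy_finite b P A B \<longleftrightarrow>
     absolutely_continuous (lborel \<Otimes>\<^sub>M lborel) (distr P (lborel \<Otimes>\<^sub>M lborel) (\<lambda>\<omega>. (A \<omega>, B \<omega>))) \<and>
     integrable (distr P (lborel \<Otimes>\<^sub>M lborel) (\<lambda>\<omega>. (A \<omega>, B \<omega>)))
       (\<lambda>(x, y). log b
          (enn2real (RN_deriv (lborel \<Otimes>\<^sub>M lborel) (distr P (lborel \<Otimes>\<^sub>M lborel) (\<lambda>\<omega>. (A \<omega>, B \<omega>))) (x, y)) /
           enn2real (RN_deriv lborel (distr P lborel B) y)))"

text \<open>
  \<open>h(A\<^sub>G|B\<^sub>G)\<close>: the pair \<open>(B\<^sub>G, A\<^sub>G)\<close> is realised by the two blocks of a Gaussian vector having the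
  mean and covariance matrix of \<open>(B, A)\<close>.
\<close>

definition gaussian_cond_entropy ::
    "real \<Rightarrow> 'a measure \<Rightarrow> ('a \<Rightarrow> real ^ 'c) \<Rightarrow> ('a \<Rightarrow> real ^ 'm) \<Rightarrow> real" where
  "gaussian_cond_entropy b P A B =
     (let V = (\<lambda>\<omega>. join_blocks (B \<omega>) (A \<omega>))
      in cond_diff_entropy b (gaussian_measure (mean_vector P V) (cov_matrix P V)) last_block first_block)"

definition cond_divergence ::
    "real \<Rightarrow> 'a measure \<Rightarrow> ('a \<Rightarrow> real ^ 'c) \<Rightarrow> ('a \<Rightarrow> real ^ 'm) \<Rightarrow> real" where
  "cond_divergence b P A B = gaussian_cond_entropy b P A B - cond_diff_entropy b P A B"

text \<open>
  \<open>L\<^sub>S(X \<rightarrow> g(X))\<close>. The partitions are the finite measurable ones, so that all mutual informations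
  are finite; the quantized variable takes as value the cell containing \<open>S\<close>.
\<close>

definition quantize :: "'s set set \<Rightarrow> 's \<Rightarrow> 's set" where
  "quantize Q s = (THE A. A \<in> Q \<and> s \<in> A)"

definition relevant_loss ::
    "real \<Rightarrow> 'a measure \<Rightarrow> ('a \<Rightarrow> 's::topological_space) \<Rightarrow> ('a \<Rightarrow> 'x::topological_space) \<Rightarrow>
     ('x \<Rightarrow> 'y::topological_space) \<Rightarrow> ereal" where
  "relevant_loss b P S X g =
     (SUP Q \<in> {Q. finite Q \<and> Q \<subseteq> sets borel \<and> partition_on UNIV Q}.
        ereal (prob_space.mutual_information P b (count_space Q) borel (\<lambda>\<omega>. quantize Q (S \<omega>)) X
             - prob_space.mutual_information P b (count_space Q) borel (\<lambda>\<omega>. quantize Q (S \<omega>)) (\<lambda>\<omega>. g (X \<omega>))))"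

abbreviation head_coords :: "real ^ ('m::finite + 'c::finite) ^ ('m + 'c) \<Rightarrow> real ^ ('m + 'c) \<Rightarrow> real ^ 'm" where
  "head_coords V x \<equiv> first_block (transpose V *v x)"

abbreviation tail_coords :: "real ^ ('m::finite + 'c::finite) ^ ('m + 'c) \<Rightarrow> real ^ ('m + 'c) \<Rightarrow> real ^ 'c" where
  "tail_coords V x \<equiv> last_block (transpose V *v x)"

text \<open>
  \<open>h(Y\<^sub>c\<^sub>,\<^sub>G|Y\<^sub>M\<^sub>,\<^sub>G) - h(N\<^sub>c\<^sub>,\<^sub>G|N\<^sub>M\<^sub>,\<^sub>G)\<close> for the coordinates \<open>V\<^sup>T X\<close> and \<open>V\<^sup>T N\<close>.
\<close>

definition gaussian_bound ::
    "real \<Rightarrow> 'a measure \<Rightarrow> ('a \<Rightarrow> real ^ ('m::finite + 'c::finite)) \<Rightarrow> ('a \<Rightarrow> real ^ ('m + 'c)) \<Rightarrow>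
     real ^ ('m + 'c) ^ ('m + 'c) \<Rightarrow> real" where
  "gaussian_bound b P X N V =
     gaussian_cond_entropy b P (\<lambda>\<omega>. tail_coords V (X \<omega>)) (\<lambda>\<omega>. head_coords V (X \<omega>))
   - gaussian_cond_entropy b P (\<lambda>\<omega>. tail_coords V (N \<omega>)) (\<lambda>\<omega>. head_coords V (N \<omega>))"

end

theory Submission
  imports Defs
begin

text \<open>
  The loss \<open>I(T;X) - I(T;Y\<^sub>M)\<close> of a quantization \<open>T\<close> of \<open>S\<close> is the expected logarithm of the ratio of the
  posteriors of \<open>T\<close>, and \<open>h(Y\<^sub>c|Y\<^sub>M) - h(N\<^sub>c|N\<^sub>M)\<close> is the expected logarithm of a ratio of conditional
  densities. The two differ by the expectation of \<open>log U\<close>, where \<open>U\<close> is the quotient of the conditional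
  densities of \<open>Y\<^sub>c\<close> given \<open>(Y\<^sub>M, T)\<close> and given \<open>(Y\<^sub>M, S)\<close>; since the mean of \<open>U\<close> is at most \<open>1\<close>, the loss is
  bounded by the entropy difference, and the hypothesis on the divergences turns this into the
  Gaussian bound.

  For a Gaussian vector with covariance \<open>C\<close>, \<open>h(Y\<^sub>c|Y\<^sub>M)\<close> is \<open>(log (det C / det C\<^sub>M\<^sub>M)) / 2\<close> up to a constant. As the noise is
  white, minimizing the bound over \<open>V\<close> amounts to maximizing
  \<open>det (A\<^sup>T C A) / det (A\<^sup>T A)\<close>, where \<open>A\<close> consists of the first \<open>M\<close> columns of \<open>V\<close>. By the Cauchy-Binet
  formula in an eigenbasis, the maximum is the product of the \<open>M\<close> largest eigenvalues.
\<close>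

section \<open>Weighted Gram determinants\<close>

text \<open>Two obstacles shape the proof. \<open>S\<close> may have any law, even a discrete one,
  so mutual informations are computed from posteriors taken relative to the law of \<open>X\<close>;
  Lebesgue densities belong to \<open>X\<close> and \<open>N\<close> only. By independence, the law
  of \<open>X\<close> given \<open>S = s\<close> is a translate of the noise law, and translation
  invariance of Lebesgue measure then controls the mean of \<open>U\<close>. An inequality rather
  than an equality results because densities may vanish.

  On the Gaussian side, integrating a block out of a general Gaussian density would lead to Schur
  complements. Instead the covariance is written as \<open>transpose R ** R\<close> with
  \<open>R\<close> block triangular, so that the marginal can be read off. Such roots exist because
  a joint density forces all eigenvalues and the noise variance to be positive. The additive
  constants of the two Gaussian entropies agree and cancel, and so does \<open>det V\<close>; this
  is why the competitors \<open>V\<close> may be arbitrary invertible matrices.\<close>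

lemma det_weighted_gram:
  fixes B :: "real^'m^'n" and l :: "'n \<Rightarrow> real"
  shows "det (\<chi> i j. \<Sum>k\<in>UNIV. l k * B$k$i * B$k$j :: real^'m^'m)
    = (\<Sum>f\<in>UNIV. (\<Prod>i\<in>UNIV. l (f i)) * (\<Prod>i\<in>UNIV. B $ f i $ i) * det (\<chi> i. B $ f i))"
proof -
  let ?P = "{p. p permutes (UNIV :: 'm set)}"
  \<comment> \<open>Expanding the product of sums picks one index \<open>f i\<close> for every row
    \<open>i\<close>. The factors that still depend on \<open>p\<close> form the Leibniz sum of the
    selected rows.\<close>
  have "det (\<chi> i j. \<Sum>k\<in>UNIV. l k * B$k$i * B$k$j :: real^'m^'m)
      = (\<Sum>p\<in>?P. of_int (sign p) * (\<Sum>f\<in>UNIV. \<Prod>i\<in>UNIV. l (f i) * B $ f i $ i * B $ f i $ p i))"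
    by (simp add: det_def prod_sum_PiE PiE_UNIV_domain)
  also have "\<dots> = (\<Sum>p\<in>?P. \<Sum>f\<in>UNIV. (\<Prod>i\<in>UNIV. l (f i)) * (\<Prod>i\<in>UNIV. B $ f i $ i) *
      (of_int (sign p) * (\<Prod>i\<in>UNIV. B $ f i $ p i)))"
    by (simp add: sum_distrib_left prod.distrib mult_ac)
  also have "\<dots> = (\<Sum>f\<in>UNIV. \<Sum>p\<in>?P. (\<Prod>i\<in>UNIV. l (f i)) * (\<Prod>i\<in>UNIV. B $ f i $ i) *
      (of_int (sign p) * (\<Prod>i\<in>UNIV. B $ f i $ p i)))"
    by (rule sum.swap)
  also have "\<dots> = (\<Sum>f\<in>UNIV. (\<Prod>i\<in>UNIV. l (f i)) * (\<Prod>i\<in>UNIV. B $ f i $ i) * det (\<chi> i. B $ f i))"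
    by (simp add: sum_distrib_left det_def)
  finally show ?thesis .
qed

text \<open>The Cauchy-Binet formula; summing over all maps instead of index subsets costs the factor \<open>fact\<close>.\<close>

lemma fact_det_weighted_gram:
  fixes B :: "real^'m^'n" and l :: "'n \<Rightarrow> real"
  shows "fact CARD('m) * det (\<chi> i j. \<Sum>k\<in>UNIV. l k * B$k$i * B$k$j :: real^'m^'m)
    = (\<Sum>f\<in>UNIV. (\<Prod>i\<in>UNIV. l (f i)) * (det (\<chi> i. B $ f i))\<^sup>2)" (is "_ * ?D = _")
proof -
  let ?P = "{p. p permutes (UNIV :: 'm set)}"
  let ?g = "\<lambda>f. (\<Prod>i\<in>UNIV. l (f i)) * (\<Prod>i\<in>UNIV. B $ f i $ i) * det (\<chi> i. B $ f i)"
  \<comment> \<open>Reindexing by \<open>f \<circ> p\<close> leaves the weight alone, and the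
    determinant contributes \<open>sign p\<close>. Summing over all \<open>p\<close> then assembles
    the factors \<open>B $ f (p i) $ i\<close> into a second determinant, whence the square.\<close>
  have *: "?D = (\<Sum>f\<in>UNIV. (\<Prod>i\<in>UNIV. l (f i)) * det (\<chi> i. B $ f i) *
       (of_int (sign p) * (\<Prod>i\<in>UNIV. B $ f (p i) $ i)))" if p: "p \<in> ?P" for p
  proof -
    have p': "p permutes UNIV" using p by simp
    have bij: "bij p" using p' by (simp add: permutes_bij)
    have "bij (\<lambda>f :: 'm \<Rightarrow> 'n. f \<circ> p)"
      by (rule o_bij[where g="\<lambda>f. f \<circ> inv p"])
        (auto simp: fun_eq_iff bij[THEN bij_is_surj, THEN surj_f_inv_f] bij[THEN bij_is_inj, THEN inv_f_f])
    then have "(\<Sum>f\<in>UNIV. ?g f) = (\<Sum>f\<in>UNIV. ?g (f \<circ> p))"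
      by (rule sum.reindex_bij_betw[symmetric])
    also have "\<dots> = (\<Sum>f\<in>UNIV. (\<Prod>i\<in>UNIV. l (f i)) * det (\<chi> i. B $ f i) *
       (of_int (sign p) * (\<Prod>i\<in>UNIV. B $ f (p i) $ i)))"
    proof (rule sum.cong[OF refl])
      fix f :: "'m \<Rightarrow> 'n"
      have "det (\<chi> i. B $ (f \<circ> p) i) = of_int (sign p) * det (\<chi> i. B $ f i)"
        using det_permute_rows[OF p', of "\<chi> i. B $ f i"] by simp
      moreover have "(\<Prod>i\<in>UNIV. l ((f \<circ> p) i)) = (\<Prod>i\<in>UNIV. l (f i))"
        using prod.reindex_bij_betw[OF bij, of "\<lambda>i. l (f i)"] by simp
      ultimately show "?g (f \<circ> p) = (\<Prod>i\<in>UNIV. l (f i)) * det (\<chi> i. B $ f i) *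
       (of_int (sign p) * (\<Prod>i\<in>UNIV. B $ f (p i) $ i))"
        by simp
    qed
    finally show ?thesis by (simp add: det_weighted_gram)
  qed
  have "fact CARD('m) * ?D = (\<Sum>p\<in>?P. ?D)"
    by (simp add: card_permutations)
  also have "\<dots> = (\<Sum>p\<in>?P. \<Sum>f\<in>UNIV. (\<Prod>i\<in>UNIV. l (f i)) * det (\<chi> i. B $ f i) *
       (of_int (sign p) * (\<Prod>i\<in>UNIV. B $ f (p i) $ i)))"
    by (rule sum.cong[OF refl *])
  also have "\<dots> = (\<Sum>f\<in>UNIV. \<Sum>p\<in>?P. (\<Prod>i\<in>UNIV. l (f i)) * det (\<chi> i. B $ f i) *
       (of_int (sign p) * (\<Prod>i\<in>UNIV. B $ f (p i) $ i)))"
    by (rule sum.swap)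
  also have "\<dots> = (\<Sum>f\<in>UNIV. (\<Prod>i\<in>UNIV. l (f i)) * det (\<chi> i. B $ f i) * det (transpose (\<chi> i. B $ f i)))"
    unfolding det_def[of "transpose _"] by (simp add: sum_distrib_left transpose_def)
  finally show ?thesis by (simp add: power2_eq_square mult.assoc)
qed

lemma prod_le_prod_top_block:
  fixes l :: "'m::finite + 'c::finite \<Rightarrow> real" and f :: "'m \<Rightarrow> 'm + 'c"
  assumes "inj f" and nn: "\<And>k. 0 \<le> l k" and le: "\<And>i j. l (Inr j) \<le> l (Inl i)"
  shows "(\<Prod>i\<in>UNIV. l (f i)) \<le> (\<Prod>i\<in>UNIV. l (Inl i))"
proof -
  let ?I = "range f" and ?T = "range (Inl :: 'm \<Rightarrow> 'm + 'c)"
  have "card ?I = card ?T"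
    using \<open>inj f\<close> by (simp add: card_image)
  then have "card (?I - ?T) = card (?T - ?I)"
    by (simp add: card_Diff_subset_Int Int_commute)
  then obtain h where h: "bij_betw h (?I - ?T) (?T - ?I)"
    using finite_same_card_bij[of "?I - ?T" "?T - ?I"] by auto
  have "(\<Prod>i\<in>UNIV. l (f i)) = prod l ?I"
    using prod.reindex[OF \<open>inj f\<close>, of l] by simp
  also have "\<dots> = prod l (?I \<inter> ?T) * prod l (?I - ?T)"
    by (rule prod.Int_Diff) simp
  also have "prod l (?I - ?T) \<le> (\<Prod>k\<in>?I - ?T. l (h k))"
  proof (intro prod_mono conjI nn)
    fix k assume k: "k \<in> ?I - ?T"
    then obtain j where "k = Inr j" by (cases k) auto
    moreover obtain i where "h k = Inl i"
      using bij_betwE[OF h] k by blast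
    ultimately show "l k \<le> l (h k)" using le by simp
  qed
  then have "prod l (?I \<inter> ?T) * prod l (?I - ?T) \<le> prod l (?T \<inter> ?I) * (\<Prod>k\<in>?I - ?T. l (h k))"
    by (simp add: Int_commute mult_left_mono prod_nonneg nn)
  also have "(\<Prod>k\<in>?I - ?T. l (h k)) = prod l (?T - ?I)"
    by (rule prod.reindex_bij_betw[OF h])
  also have "prod l (?T \<inter> ?I) * prod l (?T - ?I) = prod l ?T"
    by (rule prod.Int_Diff[symmetric]) simp
  also have "\<dots> = (\<Prod>i\<in>UNIV. l (Inl i))"
    by (subst prod.reindex) auto
  finally show ?thesis .
qed

text \<open>The minors enter the Cauchy-Binet sum squared, so the weights can be compared term by
  term. A map \<open>f\<close> that is not injective repeats a row and contributes 0.\<close>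

lemma det_weighted_gram_le:
  fixes B :: "real^'m^('m::finite + 'c::finite)" and l :: "'m + 'c \<Rightarrow> real"
  assumes nn: "\<And>k. 0 \<le> l k" and le: "\<And>i j. l (Inr j) \<le> l (Inl i)"
  shows "det (\<chi> i j. \<Sum>k\<in>UNIV. l k * B$k$i * B$k$j :: real^'m^'m)
    \<le> (\<Prod>i\<in>UNIV. l (Inl i)) * det (\<chi> i j. \<Sum>k\<in>UNIV. B$k$i * B$k$j :: real^'m^'m)"
proof -
  have "(\<Sum>f\<in>UNIV. (\<Prod>i\<in>UNIV. l (f i)) * (det (\<chi> i. B $ f i))\<^sup>2)
      \<le> (\<Sum>f\<in>UNIV. (\<Prod>i\<in>UNIV. l (Inl i)) * (det (\<chi> i. B $ f i))\<^sup>2)"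
  proof (rule sum_mono)
    fix f :: "'m \<Rightarrow> 'm + 'c"
    show "(\<Prod>i\<in>UNIV. l (f i)) * (det (\<chi> i. B $ f i))\<^sup>2 \<le> (\<Prod>i\<in>UNIV. l (Inl i)) * (det (\<chi> i. B $ f i))\<^sup>2"
    proof (cases "inj f")
      case True
      then show ?thesis
        by (intro mult_right_mono prod_le_prod_top_block nn le) auto
    next
      case False
      then obtain i j where "i \<noteq> j" "f i = f j" by (auto simp: inj_def)
      then have "det (\<chi> i. B $ f i) = 0"
        by (intro det_identical_rows[of i j]) (auto simp: row_def vec_eq_iff)
      then show ?thesis by simp
    qed
  qed
  also have "\<dots> = (\<Prod>i\<in>UNIV. l (Inl i)) * (fact CARD('m) * det (\<chi> i j. \<Sum>k\<in>UNIV. B$k$i * B$k$j :: real^'m^'m))"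
    using fact_det_weighted_gram[of "\<lambda>_. 1" B] by (simp add: sum_distrib_left)
  finally show ?thesis
    unfolding fact_det_weighted_gram[symmetric] by (simp add: mult.left_commute)
qed

section \<open>Linear images of Lebesgue measure\<close>

lemma nn_integral_lborel_translate:
  fixes c :: "'a::euclidean_space"
  assumes [measurable]: "f \<in> borel_measurable borel"
  shows "(\<integral>\<^sup>+x. f (c + x) \<partial>lborel) = (\<integral>\<^sup>+x. f x \<partial>lborel)"
  by (subst (2) lborel_distr_plus[of c, symmetric]) (simp add: nn_integral_distr)

text \<open>Uniqueness of Haar measure: integrate \<open>1\<^sub>B (x + y) 1\<^sub>C (y)\<close> in both orders, with \<open>C\<close> the unit cube.\<close>

lemma translation_invariant_eq_scaled_lborel:
  fixes \<mu> :: "'a::euclidean_space measure"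
  assumes "sigma_finite_measure \<mu>" and [measurable_cong, simp]: "sets \<mu> = sets borel"
    and inv: "\<And>a. distr \<mu> borel ((+) a) = \<mu>"
  obtains c where "\<mu> = density lborel (\<lambda>_. c)"
proof
  let ?C = "cbox 0 (\<Sum>Basis) :: 'a set"
  \<comment> \<open>For fixed \<open>y\<close>, the points \<open>x\<close> with
    \<open>y - x\<close> in the cube form a translate of the reflected cube; its measure is what the
    second order of integration leaves.\<close>
  define c where "c = emeasure \<mu> (uminus -` ?C)"
  interpret \<mu>: sigma_finite_measure \<mu> by fact
  interpret pair_sigma_finite \<mu> lborel ..
  have [simp]: "space \<mu> = UNIV" using sets_eq_imp_space_eq[of \<mu> borel] by simp
  show "\<mu> = density lborel (\<lambda>_. c)"
  proof (rule measure_eqI)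
    fix B assume "B \<in> sets \<mu>"
    then have [measurable]: "B \<in> sets borel" by simp
    have C: "emeasure lborel ?C = 1" by (simp add: emeasure_lborel_cbox_eq)
    have tr: "(\<integral>\<^sup>+x. f (a + x) \<partial>\<mu>) = (\<integral>\<^sup>+x. f x \<partial>\<mu>)" if [measurable]: "f \<in> borel_measurable borel" for f :: "'a \<Rightarrow> ennreal" and a
      by (subst (2) inv[of a, symmetric]) (simp add: nn_integral_distr)
    have "emeasure \<mu> B = (\<integral>\<^sup>+y. (\<integral>\<^sup>+x. indicator B x \<partial>\<mu>) * indicator ?C y \<partial>lborel)"
      using C by (simp add: nn_integral_cmult)
    also have "\<dots> = (\<integral>\<^sup>+y. \<integral>\<^sup>+x. indicator B (y + x) * indicator ?C y \<partial>\<mu> \<partial>lborel)"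
      using tr[of "indicator B"] by (simp add: nn_integral_multc)
    also have "\<dots> = (\<integral>\<^sup>+x. \<integral>\<^sup>+y. indicator B (y + x) * indicator ?C y \<partial>lborel \<partial>\<mu>)"
      by (subst Fubini') simp_all
    also have "\<dots> = (\<integral>\<^sup>+x. \<integral>\<^sup>+y. indicator B y * indicator ?C (y - x) \<partial>lborel \<partial>\<mu>)"
    proof (rule nn_integral_cong)
      fix x
      show "(\<integral>\<^sup>+y. indicator B (y + x) * indicator ?C y \<partial>lborel) = (\<integral>\<^sup>+y. indicator B y * indicator ?C (y - x) \<partial>lborel)"
        using nn_integral_lborel_translate[of "\<lambda>y. indicator B y * indicator ?C (y - x)" x] by (simp add: add.commute)
    qed
    also have "\<dots> = (\<integral>\<^sup>+y. \<integral>\<^sup>+x. indicator B y * indicator ?C (y - x) \<partial>\<mu> \<partial>lborel)"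
      by (subst Fubini') simp_all
    also have "\<dots> = (\<integral>\<^sup>+y. indicator B y * c \<partial>lborel)"
    proof (rule nn_integral_cong)
      fix y
      have "(\<integral>\<^sup>+x. indicator ?C (y - x) \<partial>\<mu>) = (\<integral>\<^sup>+x. indicator ?C (- x) \<partial>\<mu>)"
        using tr[of "\<lambda>x. indicator ?C (y - x)" y] by simp
      also have "\<dots> = (\<integral>\<^sup>+x. indicator (uminus -` ?C) x \<partial>\<mu>)"
        by (simp add: indicator_def)
      also have "\<dots> = c"
        unfolding c_def by (rule nn_integral_indicator) (simp add: borel_measurable_uminus measurable_sets_borel[of uminus borel])
      finally show "(\<integral>\<^sup>+x. indicator B y * indicator ?C (y - x) \<partial>\<mu>) = indicator B y * c"
        by (simp add: nn_integral_cmult)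
    qed
    finally show "emeasure \<mu> B = emeasure (density lborel (\<lambda>_. c)) B"
      by (simp add: emeasure_density mult.commute)
  qed simp
qed

lemma borel_measurable_matrix_vector_mult [measurable (raw)]:
  fixes A :: "real^'n^'m"
  assumes "f \<in> borel_measurable M"
  shows "(\<lambda>x. A *v f x) \<in> borel_measurable M"
  by (intro measurable_compose[OF assms] borel_measurable_continuous_onI
      linear_continuous_on linear_linear[THEN iffD2] matrix_vector_mul_linear)

text \<open>Translating by \<open>a\<close> after \<open>A\<close> is translating by the preimage of
  \<open>a\<close> before \<open>A\<close>, so the image measure is again translation invariant. The
  factor is identified in \<open>lborel_distr_matrix\<close>.\<close>

lemma lborel_linear_scaled:
  fixes A :: "real^'n^'n"
  assumes "invertible A"
  obtains c where "distr lborel borel ((*v) A) = density lborel (\<lambda>_. c)"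
proof (rule translation_invariant_eq_scaled_lborel)
  obtain B where AB: "A ** B = mat 1" and BA: "B ** A = mat 1" using assms by (auto simp: invertible_def)
  show "sigma_finite_measure (distr lborel borel ((*v) A))"
  proof (rule sigma_finite_measure_distr)
    have "distr (distr lborel borel ((*v) A)) borel ((*v) B) = lborel"
      by (subst distr_distr) (simp_all add: o_def matrix_vector_mul_assoc BA distr_id2)
    then show "sigma_finite_measure (distr (distr lborel borel ((*v) A)) borel ((*v) B))"
      by (simp add: lborel.sigma_finite_measure_axioms)
  qed simp
  fix a
  have "distr (distr lborel borel ((*v) A)) borel ((+) a) = distr (distr lborel borel ((+) (B *v a))) borel ((*v) A)"
    by (simp add: distr_distr o_def matrix_vector_right_distrib matrix_vector_mul_assoc AB)
  then show "distr (distr lborel borel ((*v) A)) borel ((+) a) = distr lborel borel ((*v) A)"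
    by (simp add: lborel_distr_plus)
qed (auto intro: that)

lemma density_lborel_const_inject:
  fixes c d :: ennreal
  assumes "density (lborel :: 'a::euclidean_space measure) (\<lambda>_. c) = density lborel (\<lambda>_. d)"
  shows "c = d"
proof -
  have "emeasure (density (lborel :: 'a measure) (\<lambda>_. c)) (cbox 0 (\<Sum>Basis)) = emeasure (density (lborel :: 'a measure) (\<lambda>_. d)) (cbox 0 (\<Sum>Basis))"
    using assms by simp
  then show ?thesis
    by (simp add: emeasure_density emeasure_lborel_cbox_eq nn_integral_cmult)
qed

lemma distr_matrix_mult:
  fixes A B :: "real^'n^'n"
  assumes A: "distr lborel borel ((*v) A) = density lborel (\<lambda>_. c)"
    and B: "distr lborel borel ((*v) B) = density lborel (\<lambda>_. d)"
  shows "distr lborel borel ((*v) (A ** B)) = density lborel (\<lambda>_. c * d)"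
proof -
  have "distr lborel borel ((*v) (A ** B)) = distr (distr lborel borel ((*v) B)) borel ((*v) A)"
    by (subst distr_distr) (simp_all add: o_def matrix_vector_mul_assoc)
  also have "\<dots> = distr (density lborel (\<lambda>_. d)) borel ((*v) A)" by (simp add: B)
  also have "\<dots> = density (distr lborel borel ((*v) A)) (\<lambda>_. d)"
    by (simp add: density_distr)
  also have "\<dots> = density lborel (\<lambda>_. c * d)"
    by (simp add: A density_density_eq)
  finally show ?thesis .
qed

text \<open>The library has this only for index types of class \<open>wellorder\<close>. The scaling factor of an involution
  squares to \<open>1\<close>; swaps are involutions, and a shear is an involution times a diagonal matrix.\<close>

proposition lborel_distr_matrix:
  fixes A :: "real^'n^'n"
  assumes "invertible A"
  shows "distr lborel borel ((*v) A) = density lborel (\<lambda>_. ennreal (1 / \<bar>det A\<bar>))"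
proof -
  \<comment> \<open>The guard \<open>invertible A\<close> settles matrices with a zero row and lets
    the claim pass to products, since a product is invertible only if both factors are.\<close>
  let ?Q = "\<lambda>A :: real^'n^'n. invertible A \<longrightarrow>
    distr lborel borel ((*v) A) = density lborel (\<lambda>_. ennreal (1 / \<bar>det A\<bar>))"
  have mult: "?Q (A ** B)" if "?Q A" "?Q B" for A B
  proof
    assume "invertible (A ** B)"
    then have "invertible A" "invertible B" by (auto simp: invertible_det_nz det_mul)
    then show "distr lborel borel ((*v) (A ** B)) = density lborel (\<lambda>_. ennreal (1 / \<bar>det (A ** B)\<bar>))"
      using that distr_matrix_mult[of A _ B]
      by (simp add: det_mul abs_mult ennreal_mult[symmetric])
  qed
  have invol: "?Q A" if A: "A ** A = mat 1" for A
  proof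
    assume "invertible A"
    then obtain c where c: "distr lborel borel ((*v) A) = density lborel (\<lambda>_. c)"
      by (rule lborel_linear_scaled)
    have "density (lborel :: (real^'n) measure) (\<lambda>_. c * c) = density lborel (\<lambda>_. 1)"
      using distr_matrix_mult[OF c c] distr_id2[of borel "lborel :: (real^'n) measure"]
      by (simp add: A density_1 matrix_vector_mul_lid[abs_def])
    then have "c * c = 1" by (rule density_lborel_const_inject)
    then have "c = 1"
      by (cases c) (auto simp: ennreal_mult[symmetric] ennreal_eq_1 square_eq_1_iff ennreal_top_mult ennreal_mult_top)
    moreover have "\<bar>det A\<bar> = 1"
      using arg_cong[OF A, of det] by (auto simp: det_mul square_eq_1_iff)
    ultimately show "distr lborel borel ((*v) A) = density lborel (\<lambda>_. ennreal (1 / \<bar>det A\<bar>))"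
      using c by simp
  qed
  have diag: "?Q A" if A: "\<And>i j. i \<noteq> j \<Longrightarrow> A$i$j = 0" for A
  proof
    assume "invertible A"
    then have "(\<Prod>i\<in>UNIV. A$i$i) \<noteq> 0"
      using det_diagonal[of A] A by (simp add: invertible_det_nz)
    then have nz: "A$i$i \<noteq> 0" for i by auto
    have B: "Basis = (\<lambda>i. axis i (1::real)) ` (UNIV :: 'n set)" by (auto simp: Basis_vec_def)
    have inj: "inj (\<lambda>i::'n. axis i (1::real))" by (auto simp: inj_def axis_eq_axis)
    \<comment> \<open>\<open>lborel_affine_euclidean\<close> takes scale factors indexed by basis
      vectors, so the diagonal is transported along \<open>axis\<close>.\<close>
    define c where "c b = (THE r. \<exists>i. b = axis i (1::real) \<and> r = A$i$i)" for b :: "real^'n"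
    have c: "c (axis i 1) = A$i$i" for i
      unfolding c_def by (auto simp: axis_eq_axis)
    have A_eq: "A *v x = 0 + (\<Sum>j\<in>Basis. (c j * (x \<bullet> j)) *\<^sub>R j)" for x
    proof -
      have "(A *v x) $ k = (\<Sum>i\<in>UNIV. A$i$i * x$i * axis i 1 $ k)" for k
        using A by (auto simp: matrix_vector_mult_def axis_def if_distrib[of "\<lambda>t. _ * t"]
            sum.remove[of UNIV k] intro!: sum.neutral)
      then show ?thesis
        by (simp add: B sum.reindex[OF inj] c inner_axis vec_eq_iff)
    qed
    have "(lborel :: (real^'n) measure) = density (distr lborel borel ((*v) A)) (\<lambda>_. (\<Prod>j\<in>Basis. \<bar>c j\<bar>))"
      unfolding fun_eq_iff[THEN iffD2, OF allI, OF A_eq]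
      by (rule lborel_affine_euclidean) (use nz in \<open>auto simp: B c\<close>)
    also have "(\<Prod>j\<in>Basis. \<bar>c j\<bar>) = \<bar>det A\<bar>"
      using det_diagonal[of A] A by (simp add: B prod.reindex[OF inj] c abs_prod)
    finally have *: "(lborel :: (real^'n) measure) = density (distr lborel borel ((*v) A)) (\<lambda>_. \<bar>det A\<bar>)" .
    have "density lborel (\<lambda>_. ennreal (1 / \<bar>det A\<bar>)) = distr lborel borel ((*v) A)"
      using \<open>invertible A\<close>
      by (subst *) (simp add: density_density_eq invertible_det_nz ennreal_mult[symmetric] density_1)
    then show "distr lborel borel ((*v) A) = density lborel (\<lambda>_. ennreal (1 / \<bar>det A\<bar>))" ..
  qed
  have "?Q A"
  proof (rule induct_matrix_elementary)
    fix A :: "real^'n^'n" and i assume "row i A = 0"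
    then show "?Q A" using det_zero_row(2)[of i A] by (simp add: invertible_det_nz)
  next
    fix m n :: 'n assume "m \<noteq> n"
    show "?Q (\<chi> i j. mat 1 $ i $ Transposition.transpose m n j)"
      by (rule invol) (auto simp: matrix_matrix_mult_def mat_def vec_eq_iff Transposition.transpose_def if_distrib[of "\<lambda>t. _ * t"] cong: if_cong)
  next
    fix m n :: 'n and c :: real assume "m \<noteq> n"
    let ?E = "\<chi> i j. if i = m \<and> j = n then c else of_bool (i = j) :: real^'n^'n"
    \<comment> \<open>\<open>?D\<close> flips the sign of coordinate \<open>m\<close>. Then
      \<open>?E ** ?D\<close> sends \<open>x $ m\<close> to \<open>c * x $ n - x $ m\<close> and
      fixes the other coordinates, so it squares to the identity; another factor \<open>?D\<close>
      recovers the shear.\<close>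
    let ?D = "\<chi> i j. if i = j then if i = m then -1 else 1 else 0 :: real^'n^'n"
    have ED: "?E ** ?D = (\<chi> i j. if i = m \<and> j = n then c else if i = j then if i = m then -1 else 1 else 0)"
      using \<open>m \<noteq> n\<close> by (auto simp: matrix_matrix_mult_def vec_eq_iff if_distrib[of "\<lambda>t. _ * t"] cong: if_cong)
    have ED_mult: "((?E ** ?D) *v x) $ i = (if i = m then c * x $ n - x $ m else x $ i)" for x i
    proof -
      have "((?E ** ?D) *v x) $ i = (\<Sum>k\<in>UNIV. (if k = n then if i = m then c * x $ n else 0 else 0)
          + (if k = i then if i = m then - x $ m else x $ i else 0))"
        unfolding ED matrix_vector_mult_def using \<open>m \<noteq> n\<close>
        by (simp only: vec_lambda_beta) (rule sum.cong, auto)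
      then show ?thesis by (simp only: sum.distrib sum.delta finite_class.finite) auto
    qed
    have "(?E ** ?D) ** (?E ** ?D) = mat 1"
      unfolding matrix_eq
    proof
      fix x
      have "(?E ** ?D) *v y = (\<chi> i. if i = m then c * y $ n - y $ m else y $ i)" for y
        by (rule vec_eq_iff[THEN iffD2]) (simp only: ED_mult vec_lambda_beta, simp)
      then have "(?E ** ?D) *v ((?E ** ?D) *v x) = x"
        using \<open>m \<noteq> n\<close> by (simp only:) (simp add: vec_eq_iff)
      then show "((?E ** ?D) ** (?E ** ?D)) *v x = mat 1 *v x"
        by (simp add: matrix_vector_mul_assoc)
    qed
    then have "?Q (?E ** ?D)" by (rule invol)
    moreover have "?Q ?D" by (rule diag) auto
    moreover have "?D ** ?D = mat 1"
      by (auto simp: matrix_matrix_mult_def vec_eq_iff mat_def if_distrib[of "\<lambda>t. _ * t"] cong: if_cong)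
    then have "(?E ** ?D) ** ?D = ?E" by (simp add: matrix_mul_assoc[symmetric])
    ultimately show "?Q ?E" using mult[of "?E ** ?D" ?D] by simp
  qed (fact mult, fact diag)
  then show ?thesis using assms by blast
qed

section \<open>Block coordinates\<close>

lemma Basis_vec_axis: "(Basis :: (real^'n) set) = range (\<lambda>i. axis i 1)"
  by (auto simp: Basis_vec_def)

lemma prod_Basis_vec: "(\<Prod>b\<in>Basis. g (b :: real^'n)) = (\<Prod>i\<in>UNIV. g (axis i 1))"
  unfolding Basis_vec_axis by (subst prod.reindex) (auto simp: inj_def axis_eq_axis)

lemma first_block_nth [simp]: "first_block v $ i = v $ Inl i"
  and last_block_nth [simp]: "last_block v $ j = v $ Inr j"
  and join_blocks_Inl [simp]: "join_blocks u w $ Inl i = u $ i"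
  and join_blocks_Inr [simp]: "join_blocks u w $ Inr j = w $ j"
  by (simp_all add: first_block_def last_block_def join_blocks_def)

lemma join_blocks_first_last [simp]: "join_blocks (first_block v) (last_block v) = v"
  by (simp add: vec_eq_iff split_sum_all)

lemma first_block_join [simp]: "first_block (join_blocks u w) = u"
  and last_block_join [simp]: "last_block (join_blocks u w) = w"
  by (simp_all add: vec_eq_iff)

lemma sum_UNIV_sum:
  "(\<Sum>k\<in>UNIV. g (k :: 'm::finite + 'c::finite)) = (\<Sum>i\<in>UNIV. g (Inl i)) + (\<Sum>j\<in>UNIV. g (Inr j))"
  unfolding UNIV_sum by (subst sum.union_disjoint) (auto simp: sum.reindex)

lemma prod_UNIV_sum:
  "(\<Prod>k\<in>UNIV. g (k :: 'm::finite + 'c::finite)) = (\<Prod>i\<in>UNIV. g (Inl i)) * (\<Prod>j\<in>UNIV. g (Inr j))"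
  unfolding UNIV_sum by (subst prod.union_disjoint) (auto simp: prod.reindex)

lemma linear_first_block: "linear first_block" and linear_last_block: "linear last_block"
  by (auto intro!: linearI simp: vec_eq_iff)

lemma linear_join_blocks: "linear (\<lambda>(w, u). join_blocks u w)"
  by (auto intro!: linearI simp: vec_eq_iff split_sum_all)

lemma borel_measurable_linear:
  fixes f :: "'a::euclidean_space \<Rightarrow> 'b::euclidean_space"
  shows "linear f \<Longrightarrow> f \<in> borel_measurable borel"
  by (intro borel_measurable_continuous_onI linear_continuous_on linear_linear[THEN iffD2])

lemma measurable_first_block [measurable]: "first_block \<in> borel_measurable borel"
  and measurable_last_block [measurable]: "last_block \<in> borel_measurable borel"
  by (intro borel_measurable_linear linear_first_block linear_last_block)+

lemma measurable_join_blocks [measurable (raw)]: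
  assumes "f \<in> borel_measurable M" "g \<in> borel_measurable M"
  shows "(\<lambda>x. join_blocks (f x) (g x)) \<in> borel_measurable M"
proof -
  have "(\<lambda>x. (g x, f x)) \<in> borel_measurable M"
    using assms by (intro borel_measurable_Pair)
  from measurable_compose[OF this borel_measurable_linear[OF linear_join_blocks]]
  show ?thesis by simp
qed

lemma inner_join_blocks: "join_blocks u w \<bullet> join_blocks u' w' = u \<bullet> u' + w \<bullet> w'"
  by (simp add: inner_vec_def sum_UNIV_sum)

text \<open>A box splits into two boxes whose volumes multiply. The last block comes first in the
  pair because the entropies are those of the last block given the first.\<close>

lemma lborel_join_blocks:
  "distr (lborel \<Otimes>\<^sub>M lborel) borel (\<lambda>(w, u). join_blocks u w) = (lborel :: (real^('m::finite + 'c::finite)) measure)"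
proof (rule lborel_eqI[symmetric])
  fix l u :: "real^('m + 'c)" assume lu: "\<And>b. b \<in> Basis \<Longrightarrow> l \<bullet> b \<le> u \<bullet> b"
  have le: "l $ k \<le> u $ k" for k
    using lu[of "axis k 1"] by (simp add: inner_axis)
  have "(\<lambda>(w, u). join_blocks u w) -` box l u = box (last_block l) (last_block u) \<times> box (first_block l) (first_block u)"
    by (auto simp: box_def Basis_vec_axis inner_axis split_sum_all)
  then have "emeasure (distr (lborel \<Otimes>\<^sub>M lborel) borel (\<lambda>(w, u). join_blocks u w)) (box l u)
      = emeasure lborel (box (last_block l) (last_block u)) * emeasure lborel (box (first_block l) (first_block u))"
    by (subst emeasure_distr) (auto simp: lborel.emeasure_pair_measure_Times space_pair_measure)
  also have "\<dots> = ennreal ((\<Prod>j\<in>UNIV. u $ Inr j - l $ Inr j) * (\<Prod>i\<in>UNIV. u $ Inl i - l $ Inl i))"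
    using le by (simp add: emeasure_lborel_box_eq Basis_vec_axis inner_axis
        prod_Basis_vec[unfolded Basis_vec_axis] ennreal_mult[symmetric] prod_nonneg)
  also have "\<dots> = ennreal (\<Prod>b\<in>Basis. (u - l) \<bullet> b)"
    by (simp add: prod_Basis_vec inner_axis prod_UNIV_sum mult.commute)
  finally show "emeasure (distr (lborel \<Otimes>\<^sub>M lborel) borel (\<lambda>(w, u). join_blocks u w)) (box l u) = (\<Prod>b\<in>Basis. (u - l) \<bullet> b)" .
qed simp

lemma lborel_split_blocks:
  "distr lborel (lborel \<Otimes>\<^sub>M lborel) (\<lambda>v :: real^('m::finite + 'c::finite). (last_block v, first_block v)) = lborel \<Otimes>\<^sub>M lborel"
proof -
  have "distr lborel (lborel \<Otimes>\<^sub>M lborel) (\<lambda>v :: real^('m + 'c). (last_block v, first_block v))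
      = distr (lborel \<Otimes>\<^sub>M lborel) (lborel \<Otimes>\<^sub>M lborel) ((\<lambda>v. (last_block v, first_block v)) \<circ> (\<lambda>(w, u). join_blocks u w :: real^('m + 'c)))"
    unfolding lborel_join_blocks[symmetric, where 'm='m and 'c='c] by (rule distr_distr) measurable
  also have "(\<lambda>v. (last_block v, first_block v)) \<circ> (\<lambda>(w, u). join_blocks u w :: real^('m + 'c)) = (\<lambda>p. p)"
    by (auto simp: fun_eq_iff)
  finally show ?thesis by simp
qed

section \<open>Gaussian laws\<close>

declare transpose_matrix_vector [simp del]

definition std_gaussian_density :: "real^'n \<Rightarrow> real" where
  "std_gaussian_density z = exp (- (z \<bullet> z) / 2) / sqrt ((2 * pi) ^ CARD('n))"

definition std_gaussian :: "(real^'n) measure" where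
  "std_gaussian = density lborel (\<lambda>z. ennreal (std_gaussian_density z))"

lemma std_gaussian_density_pos: "0 < std_gaussian_density z"
  by (simp add: std_gaussian_density_def)

lemma std_gaussian_density_measurable [measurable]: "std_gaussian_density \<in> borel_measurable borel"
  unfolding std_gaussian_density_def by measurable

lemma space_std_gaussian [simp]: "space std_gaussian = UNIV"
  and sets_std_gaussian [measurable_cong, simp]: "sets std_gaussian = sets borel"
  by (simp_all add: std_gaussian_def)

lemma exp_inner_eq_prod: "exp (a * (z \<bullet> z)) = (\<Prod>b\<in>Basis. exp (a * (z \<bullet> b)\<^sup>2))" for z :: "'a::euclidean_space"
  unfolding euclidean_inner[of z z] by (simp add: sum_distrib_left exp_sum power2_eq_square)

lemma nn_integral_std_gaussian_density: "(\<integral>\<^sup>+z. std_gaussian_density (z :: real^'n) \<partial>lborel) = 1"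
proof -
  have "std_gaussian_density z = (\<Prod>b\<in>Basis. std_normal_density (z \<bullet> b))" for z :: "real^'n"
    using exp_inner_eq_prod[of "-1/2" z]
    unfolding std_gaussian_density_def std_normal_density_def real_sqrt_power
    by (simp add: prod_dividef)
  moreover have "(\<integral>\<^sup>+x. std_normal_density x \<partial>lborel) = 1"
    by (subst nn_integral_eq_integral) simp_all
  ultimately show ?thesis
    by (simp add: prod_ennreal[symmetric]) (subst nn_integral_lborel_prod, auto)
qed

lemma prob_space_std_gaussian: "prob_space (std_gaussian :: (real^'n) measure)"
  using nn_integral_std_gaussian_density[where 'n='n]
  by (intro prob_spaceI) (simp add: std_gaussian_def emeasure_density)

text \<open>The last-block part of this second moment enters the entropy formula as an additive
  constant that later cancels between \<open>X\<close> and \<open>N\<close>; its integrability is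
  what has to be secured.\<close>

lemma integrable_std_gaussian_inner:
  "integrable std_gaussian (\<lambda>z :: real^'n. z \<bullet> z)"
proof -
  have "(\<integral>\<^sup>+z. ennreal (\<Prod>b\<in>Basis. exp (-1/4 * ((z :: real^'n) \<bullet> b)\<^sup>2)) \<partial>lborel) < \<infinity>"
  proof -
    \<comment> \<open>Half of the exponent absorbs the factor \<open>z \<bullet> z\<close> via
      \<open>t \<le> exp t\<close> at \<open>t = (z \<bullet> z) / 4\<close>; the other half is, per
      coordinate, a multiple of the normal density of variance 2.\<close>
    have "normal_density 0 (sqrt 2) x = exp (- (1/4 * x\<^sup>2)) / sqrt (4 * pi)" for x
      by (simp add: normal_density_def)
    then have *: "exp (- (1/4 * x\<^sup>2)) = sqrt (4 * pi) * normal_density 0 (sqrt 2) x" for x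
      by simp
    have "(\<integral>\<^sup>+x. ennreal (exp (- (1/4 * x\<^sup>2))) \<partial>lborel) < \<infinity>"
      unfolding * by (subst nn_integral_eq_integral) simp_all
    then show ?thesis
      by (simp add: prod_ennreal[symmetric])
        (subst nn_integral_lborel_prod, auto intro!: power_less_top_ennreal[THEN iffD2])
  qed
  then have fin: "integrable lborel (\<lambda>z :: real^'n. exp (-1/4 * (z \<bullet> z)))"
    by (intro integrableI_nonneg) (simp_all only: exp_inner_eq_prod, auto intro!: AE_I2 prod_nonneg)
  have "integrable lborel (\<lambda>z :: real^'n. std_gaussian_density z * (z \<bullet> z))"
  proof (rule Bochner_Integration.integrable_bound)
    show "integrable lborel (\<lambda>z :: real^'n. 4 / sqrt ((2 * pi) ^ CARD('n)) * exp (-1/4 * (z \<bullet> z)))"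
      using fin by simp
    show "AE z :: real^'n in lborel. norm (std_gaussian_density z * (z \<bullet> z)) \<le>
        norm (4 / sqrt ((2 * pi) ^ CARD('n)) * exp (-1/4 * (z \<bullet> z)))"
    proof (rule AE_I2)
      fix z :: "real^'n"
      have "1/4 * (z \<bullet> z) \<le> exp (1/4 * (z \<bullet> z))"
        using exp_ge_add_one_self[of "1/4 * (z \<bullet> z)"] by linarith
      then have "exp (- (z \<bullet> z) / 2) * (z \<bullet> z) \<le> exp (- (z \<bullet> z) / 2) * (4 * exp (1/4 * (z \<bullet> z)))"
        by (intro mult_left_mono) auto
      also have "\<dots> = 4 * exp (-1/4 * (z \<bullet> z))"
        by (simp add: exp_add[symmetric])
      finally show "norm (std_gaussian_density z * (z \<bullet> z)) \<le>
        norm (4 / sqrt ((2 * pi) ^ CARD('n)) * exp (-1/4 * (z \<bullet> z)))"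
        by (simp add: std_gaussian_density_def abs_mult divide_right_mono)
    qed
  qed measurable
  then show ?thesis
    by (simp add: std_gaussian_def integrable_real_density less_imp_le[OF std_gaussian_density_pos])
qed

lemma integrable_std_gaussian_last_block:
  "integrable std_gaussian (\<lambda>z :: real^('m::finite + 'c::finite). last_block z \<bullet> last_block z)"
proof (rule Bochner_Integration.integrable_bound[OF integrable_std_gaussian_inner])
  have "last_block z \<bullet> last_block z \<le> z \<bullet> z" for z :: "real^('m + 'c)"
    using inner_join_blocks[of "first_block z" "last_block z" "first_block z" "last_block z"] by simp
  then show "AE z :: real^('m + 'c) in std_gaussian. norm (last_block z \<bullet> last_block z) \<le> norm (z \<bullet> z)"
    by simp
qed measurable

lemma card_sum_type: "CARD('m::finite + 'c::finite) = CARD('m) + CARD('c)"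
  unfolding UNIV_sum by (subst card_Un_disjoint) (auto simp: card_image)

text \<open>The squared norm is additive over the blocks, so the density factorises and the last
  block integrates to 1.\<close>

lemma distr_first_block_std_gaussian:
  "distr std_gaussian borel (first_block :: real^('m::finite + 'c::finite) \<Rightarrow> _) = std_gaussian"
proof (rule measure_eqI)
  fix A :: "(real^'m) set" assume "A \<in> sets (distr std_gaussian borel (first_block :: real^('m + 'c) \<Rightarrow> _))"
  then have [measurable]: "A \<in> sets borel" by simp
  have fac: "std_gaussian_density (join_blocks u w) = std_gaussian_density u * std_gaussian_density w"
    for u :: "real^'m" and w :: "real^'c"
  proof -
    have "- (u \<bullet> u + w \<bullet> w) / 2 = - (u \<bullet> u) / 2 + - (w \<bullet> w) / 2" by (simp add: field_simps)
    then show ?thesis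
      by (simp only: std_gaussian_density_def inner_join_blocks exp_add card_sum_type power_add real_sqrt_mult) simp
  qed
  have "emeasure (distr std_gaussian borel (first_block :: real^('m + 'c) \<Rightarrow> _)) A
     = (\<integral>\<^sup>+v. ennreal (std_gaussian_density v) * indicator A (first_block (v :: real^('m + 'c))) \<partial>lborel)"
    by (simp add: emeasure_distr std_gaussian_def, subst emeasure_density)
      (auto simp: indicator_def measurable_sets_borel[OF measurable_first_block])
  also have "\<dots> = (\<integral>\<^sup>+p. ennreal (std_gaussian_density (join_blocks (snd p) (fst p) :: real^('m + 'c))) * indicator A (snd p) \<partial>(lborel \<Otimes>\<^sub>M lborel))"
    by (subst lborel_join_blocks[symmetric], subst nn_integral_distr) (auto simp: split_beta')
  also have "\<dots> = (\<integral>\<^sup>+u. \<integral>\<^sup>+w. ennreal (std_gaussian_density w) * (ennreal (std_gaussian_density u) * indicator A u) \<partial>(lborel :: (real^'c) measure) \<partial>lborel)"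
    by (subst lborel_pair.nn_integral_snd[symmetric])
      (auto simp: fac ennreal_mult less_imp_le[OF std_gaussian_density_pos] mult_ac)
  also have "\<dots> = (\<integral>\<^sup>+u. ennreal (std_gaussian_density u) * indicator A u \<partial>lborel)"
    by (subst nn_integral_multc) (auto simp: nn_integral_std_gaussian_density)
  finally show "emeasure (distr std_gaussian borel (first_block :: real^('m + 'c) \<Rightarrow> _)) A = emeasure std_gaussian A"
    by (simp add: std_gaussian_def emeasure_density)
qed simp

section \<open>Gaussian laws as affine images of the standard one\<close>

lemma matrix_inv_unique:
  fixes A B :: "real^'n^'n"
  assumes "A ** B = mat 1" "B ** A = mat 1"
  shows "matrix_inv A = B"
proof -
  have "A ** matrix_inv A = mat 1 \<and> matrix_inv A ** A = mat 1"
    unfolding matrix_inv_def by (rule someI[of _ B]) (use assms in auto)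
  then show ?thesis
    by (metis assms(2) matrix_mul_assoc matrix_mul_lid matrix_mul_rid)
qed

definition gaussian_density :: "real^'n \<Rightarrow> real^'n^'n \<Rightarrow> real^'n \<Rightarrow> real" where
  "gaussian_density \<mu> C x = exp (- ((x - \<mu>) \<bullet> (matrix_inv C *v (x - \<mu>))) / 2) / sqrt ((2 * pi) ^ CARD('n) * det C)"

lemma measurable_gaussian_density [measurable]: "gaussian_density \<mu> C \<in> borel_measurable borel"
  unfolding gaussian_density_def by measurable

lemma gaussian_measure_density: "gaussian_measure \<mu> C = density lborel (\<lambda>x. ennreal (gaussian_density \<mu> C x))"
  by (simp add: gaussian_measure_def gaussian_density_def)

text \<open>With \<open>G\<close> the inverse of \<open>transpose F\<close>, the quadratic form of
  the inverse covariance becomes a squared norm, that of \<open>G *v d\<close>.\<close>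

lemma matrix_inv_gram:
  fixes F :: "real^'n^'n"
  assumes "invertible F"
  obtains G where "transpose F ** G = mat 1" "G ** transpose F = mat 1"
    "matrix_inv (transpose F ** F) = transpose G ** G"
proof -
  have "invertible (transpose F)" using assms by (simp add: invertible_det_nz)
  then obtain G where G: "transpose F ** G = mat 1" "G ** transpose F = mat 1" by (auto simp: invertible_def)
  then have G': "F ** transpose G = mat 1" "transpose G ** F = mat 1"
    by (metis matrix_transpose_mul transpose_mat transpose_transpose)+
  have "matrix_inv (transpose F ** F) = transpose G ** G"
  proof (rule matrix_inv_unique)
    show "(transpose F ** F) ** (transpose G ** G) = mat 1"
      by (metis G(1) G'(1) matrix_mul_assoc matrix_mul_rid)
    show "(transpose G ** G) ** (transpose F ** F) = mat 1"
      by (metis G(2) G'(2) matrix_mul_assoc matrix_mul_rid)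
  qed
  with G that show thesis by blast
qed

text \<open>Whitening: the inverse of \<open>transpose F\<close> takes
  \<open>transpose F *v z\<close> back to \<open>z\<close>, so the exponent is that of the standard
  Gaussian.\<close>

lemma gaussian_density_affine:
  fixes F :: "real^'n^'n"
  assumes "invertible F"
  shows "gaussian_density \<mu> (transpose F ** F) (\<mu> + transpose F *v z)
    = exp (- (z \<bullet> z) / 2) / sqrt ((2 * pi) ^ CARD('n) * det (transpose F ** F))"
proof -
  obtain G where G: "transpose F ** G = mat 1" "G ** transpose F = mat 1"
    "matrix_inv (transpose F ** F) = transpose G ** G"
    using matrix_inv_gram[OF assms] by blast
  have quad: "d \<bullet> ((transpose G ** G) *v d) = (G *v d) \<bullet> (G *v d)" for d
    by (metis dot_lmul_matrix matrix_vector_mul_assoc vector_transpose_matrix)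
  have "G *v (transpose F *v z) = z"
    by (simp only: matrix_vector_mul_assoc G matrix_vector_mul_lid)
  then show ?thesis
    unfolding gaussian_density_def G quad by (simp)
qed

text \<open>The Jacobian \<open>\<bar>det F\<bar>\<close> of the affine map equals the square root
  of \<open>det (transpose F ** F)\<close>, which is the determinant factor in the Gaussian
  density.\<close>

proposition gaussian_measure_eq_distr:
  fixes F :: "real^'n^'n"
  assumes "invertible F"
  shows "gaussian_measure \<mu> (transpose F ** F) = distr std_gaussian borel (\<lambda>z. \<mu> + transpose F *v z)"
proof -
  let ?T = "transpose F" and ?g = "gaussian_density \<mu> (transpose F ** F)"
  have nz: "det F \<noteq> 0" and inv: "invertible ?T" using assms by (simp_all add: invertible_det_nz)
  have gT: "std_gaussian_density z = \<bar>det F\<bar> * ?g (\<mu> + ?T *v z)" for z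
    unfolding gaussian_density_affine[OF assms]
    using nz by (simp add: std_gaussian_density_def det_mul real_sqrt_mult)
  have "distr std_gaussian borel (\<lambda>z. \<mu> + ?T *v z)
      = density (distr lborel borel (\<lambda>z. \<mu> + ?T *v z)) (\<lambda>x. ennreal (\<bar>det F\<bar> * ?g x))"
    unfolding std_gaussian_def gT by (rule density_distr[symmetric]) measurable
  also have "distr lborel borel (\<lambda>z. \<mu> + ?T *v z) = distr (distr lborel borel ((*v) ?T)) borel ((+) \<mu>)"
    by (subst distr_distr) (simp_all add: o_def)
  also have "\<dots> = distr (density lborel (\<lambda>_. ennreal (1 / \<bar>det F\<bar>))) borel ((+) \<mu>)"
    unfolding lborel_distr_matrix[OF inv] by simp
  also have "\<dots> = density (distr lborel borel ((+) \<mu>)) (\<lambda>_. ennreal (1 / \<bar>det F\<bar>))"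
    by (simp add: density_distr)
  also have "\<dots> = density lborel (\<lambda>_. ennreal (1 / \<bar>det F\<bar>))"
    by (simp add: lborel_distr_plus)
  also have "density \<dots> (\<lambda>x. ennreal (\<bar>det F\<bar> * ?g x)) = density lborel (\<lambda>x. ennreal (?g x))"
    using nz by (simp add: density_density_eq ennreal_mult'[symmetric])
  finally show ?thesis by (simp add: gaussian_measure_density)
qed

lemma prob_space_gaussian_measure:
  fixes F :: "real^'n^'n"
  assumes "invertible F"
  shows "prob_space (gaussian_measure \<mu> (transpose F ** F))"
  unfolding gaussian_measure_eq_distr[OF assms]
  by (intro prob_space.prob_space_distr prob_space_std_gaussian) measurable

text \<open>Pulled back to the standard Gaussian, the joint and the marginal density share the head
  part of the exponent, which cancels in their quotient. A constant and the squared norm of the tail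
  remain; the mean of the latter is the last summand, the same for every \<open>Sig\<close>.\<close>

lemma gaussian_conditional_entropy_triangular:
  fixes R :: "real^('m::finite + 'c::finite)^('m + 'c)"
  assumes b: "1 < b" and R: "invertible R" and tri: "\<And>i j. R $ Inr j $ Inl i = 0"
    and Sig: "Sig = transpose R ** R"
  shows "cond_diff_entropy b (gaussian_measure \<mu> Sig) last_block first_block
    = log b (sqrt (det Sig / det (\<chi> i j. Sig $ Inl i $ Inl j :: real^'m^'m)))
      + log b (sqrt ((2 * pi) ^ CARD('c)))
      + (\<integral>z. last_block z \<bullet> last_block z \<partial>(std_gaussian :: (real^('m + 'c)) measure)) / (2 * ln b)"
    and "0 < det Sig" and "0 < det (\<chi> i j. Sig $ Inl i $ Inl j :: real^'m^'m)"
proof -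
  let ?G = "gaussian_measure \<mu> Sig"
  define R1 where "R1 = (\<chi> i j. R $ Inl i $ Inl j :: real^'m^'m)"
  define S1 where "S1 = (\<chi> i j. Sig $ Inl i $ Inl j :: real^'m^'m)"
  have S1: "S1 = transpose R1 ** R1"
    by (simp add: S1_def R1_def Sig matrix_matrix_mult_def transpose_def vec_eq_iff sum_UNIV_sum tri)
  have first: "first_block (transpose R *v z) = transpose R1 *v first_block z" for z
    by (simp add: R1_def matrix_vector_mult_def transpose_def vec_eq_iff sum_UNIV_sum tri)
  \<comment> \<open>Surjectivity suffices: the head of a solution of
    \<open>transpose R *v z = join_blocks y 0\<close> solves the equation for
    \<open>transpose R1\<close>.\<close>
  have R1: "invertible R1"
  proof -
    have RT: "invertible (transpose R)" using R by (simp add: invertible_det_nz)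
    have "\<exists>x. transpose R1 *v x = y" for y
    proof -
      obtain z where "transpose R *v z = join_blocks y 0"
        using RT by (metis invertible_def matrix_vector_mul_assoc matrix_vector_mul_lid)
      then show ?thesis using first[of z] first_block_join by metis
    qed
    then have "invertible (transpose R1)"
      by (metis invertible_right_inverse matrix_right_invertible_surjective surj_def)
    then show ?thesis by (simp add: invertible_det_nz)
  qed
  show det_pos: "0 < det Sig" using R by (auto simp: Sig det_mul invertible_det_nz zero_less_mult_iff)
  have det1_pos: "0 < det S1" using R1 by (auto simp: S1 det_mul invertible_det_nz zero_less_mult_iff)
  then show "0 < det (\<chi> i j. Sig $ Inl i $ Inl j :: real^'m^'m)" by (simp add: S1_def)
  interpret G: prob_space ?G
    unfolding Sig by (rule prob_space_gaussian_measure[OF R])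
  interpret G: information_space ?G b by unfold_locales (fact b)
  have [measurable_cong]: "sets ?G = sets borel" by (simp add: gaussian_measure_def)
  let ?p = "\<lambda>(w, u). gaussian_density \<mu> Sig (join_blocks u w)"
  \<comment> \<open>By triangularity the head of the vector is an affine image of a standard
    Gaussian under \<open>transpose R1\<close>, so its density is again explicit.\<close>
  let ?q = "gaussian_density (first_block \<mu>) S1"
  have joint: "distributed ?G (lborel \<Otimes>\<^sub>M lborel) (\<lambda>v. (last_block v, first_block v)) (\<lambda>x. ennreal (?p x))"
    unfolding distributed_def
  proof (intro conjI)
    have "density (distr lborel (lborel \<Otimes>\<^sub>M lborel) (\<lambda>v :: real^('m + 'c). (last_block v, first_block v))) (\<lambda>x. ennreal (?p x))
      = distr (density lborel (\<lambda>v. ennreal (?p (last_block v, first_block v)))) (lborel \<Otimes>\<^sub>M lborel) (\<lambda>v. (last_block v, first_block v))"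
      by (rule density_distr) measurable
    then show "distr ?G (lborel \<Otimes>\<^sub>M lborel) (\<lambda>v. (last_block v, first_block v)) = density (lborel \<Otimes>\<^sub>M lborel) (\<lambda>x. ennreal (?p x))"
      by (simp add: lborel_split_blocks gaussian_measure_density)
  qed measurable
  have marg: "distributed ?G lborel first_block (\<lambda>u. ennreal (?q u))"
    unfolding distributed_def
  proof (intro conjI)
    have "distr ?G lborel first_block = distr ?G borel first_block"
      by (rule distr_cong) simp_all
    also have "\<dots> = distr std_gaussian borel (\<lambda>z. first_block (\<mu> + transpose R *v z))"
      unfolding Sig gaussian_measure_eq_distr[OF R] by (subst distr_distr) (simp_all add: o_def)
    also have "\<dots> = distr (distr std_gaussian borel (first_block :: real^('m + 'c) \<Rightarrow> _)) borel (\<lambda>z. first_block \<mu> + transpose R1 *v z)"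
      by (subst distr_distr) (simp_all add: o_def linear_add[OF linear_first_block] first)
    also have "\<dots> = density lborel (\<lambda>u. ennreal (?q u))"
      unfolding distr_first_block_std_gaussian gaussian_measure_eq_distr[OF R1, symmetric] S1[symmetric]
      by (rule gaussian_measure_density)
    finally show "distr ?G lborel first_block = density lborel (\<lambda>u. ennreal (?q u))" .
  qed measurable
  have nn: "0 \<le> gaussian_density m C x" if "0 < det C" for m :: "real^'k" and C x
    using that by (simp add: gaussian_density_def)
  let ?h = "\<lambda>v. log b (gaussian_density \<mu> Sig v / ?q (first_block v))"
  have "G.conditional_entropy b lborel lborel last_block first_block
      = - (\<integral>(w, u). ?p (w, u) * log b (?p (w, u) / ?q u) \<partial>(lborel \<Otimes>\<^sub>M lborel))"
    by (rule G.conditional_entropy_generic_eq[OF _ _ marg _ joint])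
      (auto intro!: nn det_pos det1_pos lborel.sigma_finite_measure_axioms)
  also have "(\<integral>(w, u). ?p (w, u) * log b (?p (w, u) / ?q u) \<partial>(lborel \<Otimes>\<^sub>M lborel))
      = (\<integral>x. ?p x * log b (?p x / ?q (snd x)) \<partial>(lborel \<Otimes>\<^sub>M lborel))"
    by (simp add: split_beta')
  also have "\<dots> = (\<integral>v. log b (?p (last_block v, first_block v) / ?q (snd (last_block v, first_block v))) \<partial>?G)"
    by (rule distributed_integral[OF joint]) (auto intro: nn det_pos)
  also have "\<dots> = (\<integral>v. ?h v \<partial>?G)" by simp
  also have "\<dots> = (\<integral>z. ?h (\<mu> + transpose R *v z) \<partial>std_gaussian)"
    unfolding Sig gaussian_measure_eq_distr[OF R] by (subst integral_distr) simp_all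
  also have "\<dots> = (\<integral>z. - (log b (sqrt (det Sig / det S1)) + log b (sqrt ((2 * pi) ^ CARD('c)))) + (- 1 / (2 * ln b)) * (last_block z \<bullet> last_block z) \<partial>(std_gaussian :: (real^('m + 'c)) measure))"
  proof (rule Bochner_Integration.integral_cong[OF refl])
    fix z :: "real^('m + 'c)"
    let ?u = "first_block z" and ?w = "last_block z"
    have zz: "z \<bullet> z = ?u \<bullet> ?u + ?w \<bullet> ?w"
      using inner_join_blocks[of ?u ?w ?u ?w] by simp
    have "gaussian_density \<mu> Sig (\<mu> + transpose R *v z) / ?q (first_block (\<mu> + transpose R *v z))
      = exp (- (z \<bullet> z) / 2) / sqrt ((2 * pi) ^ CARD('m + 'c) * det Sig) / (exp (- (?u \<bullet> ?u) / 2) / sqrt ((2 * pi) ^ CARD('m) * det S1))"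
      unfolding linear_add[OF linear_first_block] first
      unfolding Sig S1 gaussian_density_affine[OF R] gaussian_density_affine[OF R1] ..
    also have "\<dots> = exp (- (?w \<bullet> ?w) / 2) / (sqrt (det Sig / det S1) * sqrt ((2 * pi) ^ CARD('c)))"
    proof -
      have "exp (- (z \<bullet> z) / 2) = exp (- (?u \<bullet> ?u) / 2) * exp (- (?w \<bullet> ?w) / 2)"
        by (simp add: zz mult_exp_exp field_simps)
      moreover have "sqrt ((2 * pi) ^ CARD('m + 'c) * det Sig) = sqrt ((2 * pi) ^ CARD('m)) * sqrt ((2 * pi) ^ CARD('c)) * sqrt (det Sig)"
        by (simp only: card_sum_type power_add real_sqrt_mult)
      moreover have "e1 * e2 / (x1 * x2 * d) / (e1 / (x1 * d1)) = e2 / (d / d1 * x2)" if "e1 \<noteq> 0" "x1 \<noteq> 0" "d1 \<noteq> 0"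
        for e1 e2 x1 x2 d d1 :: real
        using that by (simp add: field_simps)
      ultimately show ?thesis
        using det1_pos by (simp only: real_sqrt_mult real_sqrt_divide) simp
    qed
    finally have eq: "gaussian_density \<mu> Sig (\<mu> + transpose R *v z) / ?q (first_block (\<mu> + transpose R *v z))
      = exp (- (?w \<bullet> ?w) / 2) / (sqrt (det Sig / det S1) * sqrt ((2 * pi) ^ CARD('c)))" .
    have "log b (exp x) = x / ln b" for x by (simp add: log_def)
    then show "?h (\<mu> + transpose R *v z) = - (log b (sqrt (det Sig / det S1)) + log b (sqrt ((2 * pi) ^ CARD('c)))) + (- 1 / (2 * ln b)) * (last_block z \<bullet> last_block z)"
      unfolding eq using b det_pos det1_pos
      by (subst log_divide, simp, simp, subst log_mult) simp_all
  qed
  also have "\<dots> = - (log b (sqrt (det Sig / det S1)) + log b (sqrt ((2 * pi) ^ CARD('c))))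
      + (- 1 / (2 * ln b)) * (\<integral>z. last_block z \<bullet> last_block z \<partial>(std_gaussian :: (real^('m + 'c)) measure))"
  proof -
    interpret Z: prob_space "std_gaussian :: (real^('m + 'c)) measure" by (rule prob_space_std_gaussian)
    have int: "integrable std_gaussian (\<lambda>z :: real^('m + 'c). (- 1 / (2 * ln b)) * (last_block z \<bullet> last_block z))"
      by (intro integrable_mult_right integrable_std_gaussian_last_block)
    have one: "measure (std_gaussian :: (real^('m + 'c)) measure) UNIV = 1"
      using Z.prob_space by simp
    show ?thesis
      by (subst Bochner_Integration.integral_add[OF Z.integrable_const int]) (simp add: one)
  qed
  finally show "cond_diff_entropy b ?G last_block first_block
    = log b (sqrt (det Sig / det (\<chi> i j. Sig $ Inl i $ Inl j :: real^'m^'m)))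
      + log b (sqrt ((2 * pi) ^ CARD('c)))
      + (\<integral>z. last_block z \<bullet> last_block z \<partial>(std_gaussian :: (real^('m + 'c)) measure)) / (2 * ln b)"
    by (simp add: S1_def)
qed

text \<open>A Gaussian law depends on a root \<open>R\<close> of its covariance only through \<open>R\<^sup>T R\<close>; for triangular \<open>R\<close> the head of
  \<open>R\<^sup>T z\<close> depends on the head of \<open>z\<close> only.\<close>

lemma orthogonal_block_triangularization:
  fixes F :: "real^('m::finite + 'c::finite)^('m + 'c)"
  assumes "invertible F"
  obtains R :: "real^('m + 'c)^('m + 'c)" where "invertible R" "\<And>i j. R $ Inr j $ Inl i = 0" "transpose R ** R = transpose F ** F"
proof -
  let ?f = "\<lambda>u :: real^'m. F *v join_blocks u 0"
  \<comment> \<open>The orthogonal matrix \<open>K\<close> below carries the first-block coordinates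
    onto \<open>U\<close> and the last-block ones onto its orthogonal complement. Hence
    \<open>transpose K ** F\<close> maps first-block vectors to first-block vectors, while its Gram
    matrix is that of \<open>F\<close>.\<close>
  define U where "U = range ?f"
  have lin: "linear ?f"
  proof -
    have "linear (\<lambda>u :: real^'m. join_blocks u 0 :: real^('m + 'c))"
      by (auto intro!: linearI simp: vec_eq_iff split_sum_all)
    from linear_compose[OF this matrix_vector_mul_linear] show ?thesis by (simp add: o_def)
  qed
  have inj: "inj ?f"
  proof (rule injI)
    fix x y assume "?f x = ?f y"
    then have "join_blocks x 0 = (join_blocks y 0 :: real^('m + 'c))"
      using inj_matrix_vector_mult[OF assms] by (simp add: inj_eq)
    then show "x = y" by (metis first_block_join)
  qed
  have U: "subspace U" unfolding U_def by (rule linear_subspace_image[OF lin subspace_UNIV])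
  have dimU: "dim U = CARD('m)" unfolding U_def by (simp add: dim_image_eq[OF lin] inj)
  have dimU': "dim (U\<^sup>\<bottom>) = CARD('c)"
    using dim_subspace_orthogonal_to_vectors[OF U subspace_UNIV] dimU
    by (simp add: orthogonal_comp_def card_sum_type)
  obtain f1 :: "real^'m \<Rightarrow> real^('m + 'c)" where f1: "linear f1" "range f1 = U" "\<And>x. norm (f1 x) = norm x"
    using isometry_subspaces[of "UNIV :: (real^'m) set" U] U dimU by auto
  obtain f2 :: "real^'c \<Rightarrow> real^('m + 'c)" where f2: "linear f2" "range f2 = U\<^sup>\<bottom>" "\<And>x. norm (f2 x) = norm x"
    using isometry_subspaces[of "UNIV :: (real^'c) set" "U\<^sup>\<bottom>"] subspace_orthogonal_comp dimU' by auto
  let ?k = "\<lambda>v. f1 (first_block v) + f2 (last_block v)"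
  have "linear ?k"
    by (intro linear_compose_add linear_compose[unfolded o_def, OF linear_first_block f1(1)]
        linear_compose[unfolded o_def, OF linear_last_block f2(1)])
  have "orthogonal_transformation ?k"
    unfolding orthogonal_transformation
  proof (intro conjI allI)
    fix v
    have "orthogonal (f1 (first_block v)) (f2 (last_block v))"
      using f1(2) f2(2) by (auto simp: orthogonal_comp_def)
    then have "(norm (?k v))\<^sup>2 = (norm (first_block v))\<^sup>2 + (norm (last_block v))\<^sup>2"
      by (simp add: norm_add_Pythagorean f1 f2)
    also have "\<dots> = (norm v)\<^sup>2"
      using inner_join_blocks[of "first_block v" "last_block v" "first_block v" "last_block v"]
      by (simp add: power2_norm_eq_inner)
    finally show "norm (?k v) = norm v" by simp
  qed fact
  define K where "K = matrix ?k"
  have "orthogonal_matrix K"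
    unfolding K_def using \<open>orthogonal_transformation ?k\<close> orthogonal_transformation_matrix by blast
  then have KK: "transpose K ** K = mat 1" "K ** transpose K = mat 1"
    by (simp_all add: orthogonal_matrix_def)
  have K: "K *v v = ?k v" for v unfolding K_def by (rule matrix_works) (use \<open>linear ?k\<close> in \<open>simp add: linear_def scalar_mult_eq_scaleR\<close>)
  show thesis
  proof (rule that[of "transpose K ** F"])
    show "invertible (transpose K ** F)"
      using assms KK by (metis invertible_def invertible_mult)
    show "transpose (transpose K ** F) ** (transpose K ** F) = transpose F ** F"
      by (metis KK(2) matrix_mul_assoc matrix_mul_lid matrix_transpose_mul transpose_transpose)
    fix i :: 'm and j :: 'c
    have "F *v join_blocks (axis i 1) 0 \<in> U" by (simp add: U_def)
    then obtain u where u: "F *v join_blocks (axis i 1) 0 = f1 u" using f1(2) by auto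
    have "K *v join_blocks u 0 = f1 u"
      by (simp add: K linear_0[OF f2(1)])
    then have "(transpose K ** F) *v join_blocks (axis i 1) 0 = join_blocks u 0"
      using u KK(1) by (metis matrix_vector_mul_assoc matrix_vector_mul_lid)
    moreover have "join_blocks (axis i 1) 0 = (axis (Inl i) 1 :: real^('m + 'c))"
      by (simp add: vec_eq_iff split_sum_all axis_def)
    ultimately have "column (Inl i) (transpose K ** F) = join_blocks u 0"
      by (simp only: matrix_vector_mult_basis)
    then have "column (Inl i) (transpose K ** F) $ Inr j = 0" by simp
    then show "(transpose K ** F) $ Inr j $ Inl i = 0"
      by (simp add: column_def)
  qed
qed

section \<open>Covariance matrices and the Gaussian bound\<close>

lemma measurable_vec_nth [measurable (raw)]:
  fixes f :: "'a \<Rightarrow> real^'n"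
  assumes "f \<in> borel_measurable M"
  shows "(\<lambda>x. f x $ i) \<in> borel_measurable M"
  by (rule measurable_compose[OF assms]) (auto intro!: borel_measurable_linear linearI)

lemma scaled_mat_eq: "(c :: real) *\<^sub>R mat 1 = (\<chi> i j. if i = j then c else 0)"
  by (simp add: vec_eq_iff mat_def)

lemma matrix_mult_scaled_mat:
  fixes A :: "real^'n^'k" and B :: "real^'l^'n"
  shows "A ** (c *\<^sub>R mat 1) ** B = c *\<^sub>R (A ** B)"
  by (metis matrix_mul_rid matrix_scalar_ac scalar_matrix_assoc)

section \<open>Second moments under linear maps, and their positivity\<close>

lemma (in prob_space) square_integrable_components:
  fixes X :: "'a \<Rightarrow> real^'n"
  assumes [measurable]: "X \<in> borel_measurable M" and sq: "integrable M (\<lambda>\<omega>. (norm (X \<omega>))\<^sup>2)"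
  shows integrable_component: "integrable M (\<lambda>\<omega>. X \<omega> $ i)"
    and integrable_component_mult: "integrable M (\<lambda>\<omega>. (X \<omega> $ i - c) * (X \<omega> $ j - d))"
proof -
  have prod: "integrable M (\<lambda>\<omega>. X \<omega> $ i * X \<omega> $ j)" for i j
  proof (rule Bochner_Integration.integrable_bound[OF sq])
    have "\<bar>x $ i * x $ j\<bar> \<le> (norm x)\<^sup>2" for x :: "real^'n"
      unfolding abs_mult power2_eq_square
      by (intro mult_mono component_le_norm_cart) auto
    then show "AE \<omega> in M. norm (X \<omega> $ i * X \<omega> $ j) \<le> norm ((norm (X \<omega>))\<^sup>2)" by simp
  qed measurable
  have comp: "integrable M (\<lambda>\<omega>. X \<omega> $ i)" for i
  proof (rule square_integrable_imp_integrable)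
    show "integrable M (\<lambda>\<omega>. (X \<omega> $ i)\<^sup>2)" using prod[of i i] by (simp add: power2_eq_square)
  qed measurable
  show "integrable M (\<lambda>\<omega>. X \<omega> $ i)" by (rule comp)
  have "(\<lambda>\<omega>. (X \<omega> $ i - c) * (X \<omega> $ j - d)) = (\<lambda>\<omega>. X \<omega> $ i * X \<omega> $ j - d * X \<omega> $ i - c * X \<omega> $ j + c * d)"
    by (simp add: fun_eq_iff algebra_simps)
  then show "integrable M (\<lambda>\<omega>. (X \<omega> $ i - c) * (X \<omega> $ j - d))"
    using prod comp by simp
qed

lemma (in prob_space) cov_matrix_linear:
  fixes X :: "'a \<Rightarrow> real^'n"
  assumes "X \<in> borel_measurable M" and "integrable M (\<lambda>\<omega>. (norm (X \<omega>))\<^sup>2)"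
  shows "cov_matrix M (\<lambda>\<omega>. transpose V *v X \<omega>) = transpose V ** cov_matrix M X ** V"
proof -
  note int = integrable_component[OF assms] integrable_component_mult[OF assms]
  let ?m = "mean_vector M X"
  have mean: "mean_vector M (\<lambda>\<omega>. transpose V *v X \<omega>) $ i = (\<Sum>k\<in>UNIV. V $ k $ i * ?m $ k)" for i
    using int unfolding mean_vector_def vec_lambda_beta by (simp add: matrix_vector_mult_def transpose_def)
  have centered: "(transpose V *v X \<omega>) $ i - mean_vector M (\<lambda>\<omega>. transpose V *v X \<omega>) $ i
      = (\<Sum>k\<in>UNIV. V $ k $ i * (X \<omega> $ k - ?m $ k))" for \<omega> i
    unfolding mean by (simp add: matrix_vector_mult_def transpose_def right_diff_distrib sum_subtractf)
  have "cov_matrix M (\<lambda>\<omega>. transpose V *v X \<omega>) $ i $ j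
      = (\<Sum>k\<in>UNIV. \<Sum>l\<in>UNIV. V $ k $ i * V $ l $ j * cov_matrix M X $ k $ l)" for i j
  proof -
    have "cov_matrix M (\<lambda>\<omega>. transpose V *v X \<omega>) $ i $ j
      = (\<integral>\<omega>. (\<Sum>k\<in>UNIV. \<Sum>l\<in>UNIV. V $ k $ i * V $ l $ j * ((X \<omega> $ k - ?m $ k) * (X \<omega> $ l - ?m $ l))) \<partial>M)"
      unfolding cov_matrix_def vec_lambda_beta centered by (simp add: sum_product mult_ac)
    also have "\<dots> = (\<Sum>k\<in>UNIV. \<Sum>l\<in>UNIV. V $ k $ i * V $ l $ j * cov_matrix M X $ k $ l)"
      using int by (simp add: cov_matrix_def)
    finally show ?thesis .
  qed
  also have "(\<Sum>k\<in>UNIV. \<Sum>l\<in>UNIV. V $ k $ i * V $ l $ j * cov_matrix M X $ k $ l)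
      = (transpose V ** cov_matrix M X ** V) $ i $ j" for i j
    by (subst sum.swap) (simp add: matrix_matrix_mult_def transpose_def sum_distrib_left sum_distrib_right mult_ac)
  finally show ?thesis by (simp add: vec_eq_iff)
qed

lemma null_sets_component: "{v :: real^'n. v $ k = m} \<in> null_sets lborel"
proof -
  have "{v :: real^'n. v $ k = m} = {v. v \<bullet> axis k 1 = m}" by (simp add: inner_axis)
  moreover have "negligible {v :: real^'n. v \<bullet> axis k 1 = m}"
    by (rule negligible_standard_hyperplane) (simp add: Basis_vec_axis)
  ultimately show ?thesis
    by (simp add: negligible_iff_null_sets null_sets_completion_iff)
qed

text \<open>A coordinate of variance 0 is almost surely constant, which puts all mass on a
  hyperplane, a Lebesgue null set. In PCA coordinates this makes every eigenvalue and the noise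
  variance positive.\<close>

lemma (in prob_space) variance_pos_of_absolutely_continuous:
  fixes U :: "'a \<Rightarrow> real^('m::finite + 'c::finite)"
  assumes [measurable]: "U \<in> borel_measurable M" and sq: "integrable M (\<lambda>\<omega>. (norm (U \<omega>))\<^sup>2)"
    and ac: "absolutely_continuous (lborel \<Otimes>\<^sub>M lborel)
      (distr M (lborel \<Otimes>\<^sub>M lborel) (\<lambda>\<omega>. (last_block (U \<omega>), first_block (U \<omega>))))"
  shows "0 < cov_matrix M U $ k $ k"
proof (rule ccontr)
  let ?m = "mean_vector M U $ k"
  let ?A = "{p \<in> space (lborel \<Otimes>\<^sub>M lborel). join_blocks (snd p) (fst p) $ k = ?m}"
  assume "\<not> 0 < cov_matrix M U $ k $ k"
  moreover have "0 \<le> (\<integral>\<omega>. (U \<omega> $ k - ?m) * (U \<omega> $ k - ?m) \<partial>M)" by simp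
  ultimately have "(\<integral>\<omega>. (U \<omega> $ k - ?m) * (U \<omega> $ k - ?m) \<partial>M) = 0"
    by (simp add: cov_matrix_def)
  then have ae: "AE \<omega> in M. U \<omega> $ k = ?m"
    by (subst (asm) integral_nonneg_eq_0_iff_AE)
      (auto intro: integrable_component_mult[OF assms(1) sq])
  have A: "?A \<in> sets (lborel \<Otimes>\<^sub>M lborel)"
  proof -
    have "(\<lambda>p. join_blocks (snd p) (fst p) $ k) \<in> borel_measurable (lborel \<Otimes>\<^sub>M lborel)"
      by (intro measurable_vec_nth measurable_join_blocks) auto
    then have "(\<lambda>p. join_blocks (snd p) (fst p) $ k) -` {?m} \<inter> space (lborel \<Otimes>\<^sub>M lborel) \<in> sets (lborel \<Otimes>\<^sub>M lborel)"
      by (rule measurable_sets) simp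
    moreover have "?A = (\<lambda>p. join_blocks (snd p) (fst p) $ k) -` {?m} \<inter> space (lborel \<Otimes>\<^sub>M lborel)"
      by auto
    ultimately show ?thesis by (simp only:)
  qed
  have "emeasure (lborel \<Otimes>\<^sub>M lborel) ?A
      = emeasure (distr lborel (lborel \<Otimes>\<^sub>M lborel) (\<lambda>v :: real^('m + 'c). (last_block v, first_block v))) ?A"
    by (simp add: lborel_split_blocks)
  also have "\<dots> = emeasure lborel {v :: real^('m + 'c). v $ k = ?m}"
    by (subst emeasure_distr[OF _ A]) (auto simp: space_pair_measure intro!: arg_cong[where f="emeasure lborel"])
  also have "\<dots> = 0" using null_sets_component[of k ?m] by auto
  finally have "?A \<in> null_sets (lborel \<Otimes>\<^sub>M lborel)" using A by (rule null_setsI)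
  then have "emeasure (distr M (lborel \<Otimes>\<^sub>M lborel) (\<lambda>\<omega>. (last_block (U \<omega>), first_block (U \<omega>)))) ?A = 0"
    using ac by (auto simp: absolutely_continuous_def)
  then have "emeasure M {\<omega> \<in> space M. U \<omega> $ k = ?m} = 0"
    by (subst (asm) emeasure_distr[OF _ A]) (auto simp: space_pair_measure vimage_def Int_def conj_commute)
  then have "AE \<omega> in M. U \<omega> $ k \<noteq> ?m"
    by (intro AE_I'[of "{\<omega> \<in> space M. U \<omega> $ k = ?m}"]) auto
  with ae have "AE \<omega> in M. False" by eventually_elim simp
  then show False by simp
qed

text \<open>\<open>F ** V\<close> is a root of the covariance in the new coordinates; exchanging it
  for a block triangular root with the same Gram matrix reduces the claim to the triangular
  case.\<close>

lemma gaussian_cond_entropy_coords: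
  fixes X :: "'a \<Rightarrow> real^('m::finite + 'c::finite)" and V F :: "real^('m + 'c)^('m + 'c)"
  assumes "prob_space P" and b: "1 < b"
    and X: "X \<in> borel_measurable P" "integrable P (\<lambda>\<omega>. (norm (X \<omega>))\<^sup>2)"
    and F: "invertible F" "cov_matrix P X = transpose F ** F" and V: "invertible V"
  defines "Sig \<equiv> transpose V ** cov_matrix P X ** V"
  defines "S1 \<equiv> (\<chi> i j. Sig $ Inl i $ Inl j :: real^'m^'m)"
  shows "gaussian_cond_entropy b P (\<lambda>\<omega>. tail_coords V (X \<omega>)) (\<lambda>\<omega>. head_coords V (X \<omega>))
    = log b (sqrt (det Sig / det S1)) + log b (sqrt ((2 * pi) ^ CARD('c)))
      + (\<integral>z. last_block z \<bullet> last_block z \<partial>(std_gaussian :: (real^('m + 'c)) measure)) / (2 * ln b)"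
    and "0 < det Sig" and "0 < det S1"
proof -
  interpret prob_space P by fact
  obtain R :: "real^('m + 'c)^('m + 'c)" where R: "invertible R" "\<And>i j. R $ Inr j $ Inl i = 0"
    "transpose R ** R = transpose (F ** V) ** (F ** V)"
    using orthogonal_block_triangularization[of "F ** V"] F(1) V by (auto simp: invertible_mult)
  have Sig: "Sig = transpose R ** R"
    by (simp add: R(3) Sig_def F(2) matrix_transpose_mul matrix_mul_assoc)
  note main = gaussian_conditional_entropy_triangular[OF b R(1,2) Sig, folded S1_def]
  show "gaussian_cond_entropy b P (\<lambda>\<omega>. tail_coords V (X \<omega>)) (\<lambda>\<omega>. head_coords V (X \<omega>))
    = log b (sqrt (det Sig / det S1)) + log b (sqrt ((2 * pi) ^ CARD('c)))
      + (\<integral>z. last_block z \<bullet> last_block z \<partial>(std_gaussian :: (real^('m + 'c)) measure)) / (2 * ln b)"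
    unfolding gaussian_cond_entropy_def Let_def join_blocks_first_last cov_matrix_linear[OF X] Sig_def[symmetric]
    by (rule main(1))
  show "0 < det Sig" "0 < det S1" by (rule main(2), rule main(3))
qed

section \<open>Optimality of the eigenbasis\<close>

lemma det_const_weighted_gram:
  fixes B :: "real^'m^'n"
  shows "det (\<chi> i j. \<Sum>k\<in>UNIV. c * B$k$i * B$k$j :: real^'m^'m)
    = c ^ CARD('m) * det (\<chi> i j. \<Sum>k\<in>UNIV. B$k$i * B$k$j :: real^'m^'m)"
proof -
  have "fact CARD('m) * det (\<chi> i j. \<Sum>k\<in>UNIV. c * B$k$i * B$k$j :: real^'m^'m)
      = fact CARD('m) * (c ^ CARD('m) * det (\<chi> i j. \<Sum>k\<in>UNIV. B$k$i * B$k$j :: real^'m^'m))"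
    using fact_det_weighted_gram[of "\<lambda>_. c" B] fact_det_weighted_gram[of "\<lambda>_. 1" B]
    by (simp add: sum_distrib_left[symmetric] mult.left_commute)
  then show ?thesis by simp
qed

lemma transpose_diag_mult_nth:
  fixes A :: "real^'m^'n"
  shows "(transpose A ** (\<chi> i j. if i = j then d i else 0) ** A) $ i $ j = (\<Sum>k\<in>UNIV. d k * A $ k $ i * A $ k $ j)"
  by (simp add: matrix_matrix_mult_def transpose_def if_distrib[of "\<lambda>t. x * t" for x] mult_ac cong: if_cong)

text \<open>The eigenvector equations are the columns of one identity between \<open>C ** W\<close>
  and \<open>W\<close> times the diagonal matrix of the \<open>lam i\<close>; orthogonality then
  moves \<open>W\<close> to the other side.\<close>

lemma spectral_decomposition_of_eigenvectors:
  fixes C W :: "real^'n^'n"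
  assumes W: "orthogonal_matrix W" and lam: "\<And>i. C *v column i W = lam i *\<^sub>R column i W"
  shows "C = W ** (\<chi> i j. if i = j then lam i else 0) ** transpose W"
proof -
  have "(C ** W) $ i $ j = (W ** (\<chi> i j. if i = j then lam i else 0)) $ i $ j" for i j
    using arg_cong[OF lam[of j], of "\<lambda>v. v $ i"]
    by (simp add: matrix_matrix_mult_def matrix_vector_mult_def column_def if_distrib[of "\<lambda>t. _ * t"] mult.commute cong: if_cong)
  then have "C ** W = W ** (\<chi> i j. if i = j then lam i else 0)" by (simp add: vec_eq_iff)
  then show ?thesis
    using W by (metis matrix_mul_assoc matrix_mul_rid orthogonal_matrix_def)
qed

text \<open>\<open>V\<close> multiplies both full determinants by \<open>(det V)\<^sup>2\<close>,
  which cancels between signal and noise. The bound thus depends on \<open>V\<close> through one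
  quotient of Gram determinants of its first columns, to which the Cauchy-Binet estimate
  applies.\<close>

proposition eigenbasis_minimizes_gaussian_bound:
  fixes X N :: "'a \<Rightarrow> real ^ ('m::finite + 'c::finite)"
    and V W :: "real ^ ('m + 'c) ^ ('m + 'c)"
  assumes "prob_space P" and b: "1 < b"
    and X: "X \<in> borel_measurable P" "integrable P (\<lambda>\<omega>. (norm (X \<omega>))\<^sup>2)"
    and N: "N \<in> borel_measurable P" "integrable P (\<lambda>\<omega>. (norm (N \<omega>))\<^sup>2)"
    and W: "orthogonal_matrix W"
    and lam: "\<And>i. cov_matrix P X *v column i W = lam i *\<^sub>R column i W"
    and ord: "\<And>i j. lam (Inr j) \<le> lam (Inl i)"
    and iid: "cov_matrix P N = \<sigma>2 *\<^sub>R mat 1"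
    and acX: "absolutely_continuous (lborel \<Otimes>\<^sub>M lborel)
      (distr P (lborel \<Otimes>\<^sub>M lborel) (\<lambda>\<omega>. (tail_coords W (X \<omega>), head_coords W (X \<omega>))))"
    and acN: "absolutely_continuous (lborel \<Otimes>\<^sub>M lborel)
      (distr P (lborel \<Otimes>\<^sub>M lborel) (\<lambda>\<omega>. (tail_coords W (N \<omega>), head_coords W (N \<omega>))))"
    and V: "invertible V"
  shows "gaussian_bound b P X N W \<le> gaussian_bound b P X N V"
proof -
  interpret prob_space P by fact
  have WW: "transpose W ** W = mat 1" "W ** transpose W = mat 1"
    using W by (auto simp: orthogonal_matrix_def)
  then have invW: "invertible W" by (auto simp: invertible_def)
  define D where "D = (\<chi> i j. if i = j then lam i else 0 :: real^('m + 'c)^('m + 'c))"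
  have C: "cov_matrix P X = W ** D ** transpose W"
    unfolding D_def by (rule spectral_decomposition_of_eigenvectors[OF W lam])
  have sq: "integrable P (\<lambda>\<omega>. (norm (transpose W *v Z \<omega>))\<^sup>2)" if "integrable P (\<lambda>\<omega>. (norm (Z \<omega>))\<^sup>2)" for Z :: "'a \<Rightarrow> real^('m + 'c)"
  proof -
    have "orthogonal_transformation ((*v) (transpose W))"
      using W by (simp add: orthogonal_transformation_matrix orthogonal_matrix_def)
    then show ?thesis using that by (simp add: orthogonal_transformation_norm)
  qed
  have "transpose W ** cov_matrix P X ** W = D"
    unfolding C by (metis WW(1) matrix_mul_assoc matrix_mul_lid matrix_mul_rid)
  then have lam_pos: "0 < lam k" for k
    using variance_pos_of_absolutely_continuous[OF _ sq[OF X(2)] acX, of k] X(1)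
    by (simp add: cov_matrix_linear[OF X] D_def)
  have "transpose W ** cov_matrix P N ** W = \<sigma>2 *\<^sub>R mat 1"
    by (simp add: iid WW matrix_mult_scaled_mat)
  \<comment> \<open>Every diagonal entry of a scaled identity is the scalar itself, so an arbitrary
    index, here \<open>undefined\<close>, will do.\<close>
  then have \<sigma>2_pos: "0 < \<sigma>2"
    using variance_pos_of_absolutely_continuous[OF _ sq[OF N(2)] acN, of "undefined"] N(1)
    by (simp add: cov_matrix_linear[OF N] mat_def)
  \<comment> \<open>A root of the covariance read off from its spectral decomposition; it is
    invertible because all eigenvalues are positive.\<close>
  define FX where "FX = (\<chi> i j. if i = j then sqrt (lam i) else 0) ** transpose W"
  have FX: "invertible FX" "cov_matrix P X = transpose FX ** FX"
  proof -
    let ?E = "(\<chi> i j. if i = j then sqrt (lam i) else 0) :: real^('m + 'c)^('m + 'c)"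
    have "det ?E = (\<Prod>i\<in>UNIV. sqrt (lam i))" by (simp add: det_diagonal)
    also have "\<dots> \<noteq> 0" using lam_pos by (simp add: less_imp_neq[THEN not_sym])
    finally have "invertible ?E" by (simp add: invertible_det_nz)
    then show "invertible FX" using invW by (simp add: FX_def invertible_det_nz det_mul)
    have E: "transpose ?E ** ?E = D"
      using lam_pos by (auto simp: vec_eq_iff D_def matrix_matrix_mult_def transpose_def
          if_distrib[of "\<lambda>t. _ * t"] less_imp_le cong: if_cong)
    then show "cov_matrix P X = transpose FX ** FX"
      unfolding C E[symmetric] FX_def by (simp add: matrix_transpose_mul matrix_mul_assoc)
  qed
  define FN where "FN = sqrt \<sigma>2 *\<^sub>R (mat 1 :: real^('m + 'c)^('m + 'c))"
  have "transpose FN = FN" by (auto simp: FN_def transpose_def mat_def vec_eq_iff)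
  then have FN: "cov_matrix P N = transpose FN ** FN"
    using \<sigma>2_pos by (simp add: iid FN_def matrix_scalar_ac scalar_matrix_assoc[symmetric])
  have "FN ** ((1 / sqrt \<sigma>2) *\<^sub>R mat 1) = mat 1"
    using \<sigma>2_pos by (simp add: FN_def matrix_scalar_ac scalar_matrix_assoc[symmetric])
  then have invFN: "invertible FN" by (auto simp: invertible_right_inverse)
  define SX where "SX V = transpose V ** cov_matrix P X ** V" for V :: "real^('m + 'c)^('m + 'c)"
  define SN where "SN V = transpose V ** cov_matrix P N ** V" for V :: "real^('m + 'c)^('m + 'c)"
  \<comment> \<open>The first columns of \<open>V\<close> in coordinates with respect to the
    eigenbasis; there the covariance is diagonal, and the head block becomes a weighted Gram
    matrix.\<close>
  define B where "B V = (\<chi> k i. ((transpose W ** V) :: real^('m + 'c)^('m + 'c)) $ k $ Inl i :: real^'m^('m + 'c))" for V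
  let ?gram = "\<lambda>l V. (\<chi> i j. \<Sum>k\<in>UNIV. l k * B V $ k $ i * B V $ k $ j :: real^'m^'m)"
  have SX1: "(\<chi> i j. SX V $ Inl i $ Inl j) = ?gram lam V" for V
  proof -
    have SX: "SX V = transpose (transpose W ** V) ** D ** (transpose W ** V)"
      by (simp add: SX_def C matrix_transpose_mul matrix_mul_assoc)
    show ?thesis
      by (simp add: vec_eq_iff SX D_def transpose_diag_mult_nth B_def)
  qed
  have SN1: "(\<chi> i j. SN V $ Inl i $ Inl j) = ?gram (\<lambda>_. \<sigma>2) V" for V
  proof -
    have "W ** (transpose W ** V) = V" by (simp add: matrix_mul_assoc WW)
    then have SN: "SN V = transpose (transpose W ** V) ** (\<chi> i j. if i = j then \<sigma>2 else 0) ** (transpose W ** V)"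
      unfolding scaled_mat_eq[symmetric] matrix_mult_scaled_mat SN_def iid
      by (simp add: matrix_transpose_mul matrix_mul_assoc[symmetric])
    show ?thesis
      by (simp add: vec_eq_iff SN transpose_diag_mult_nth B_def)
  qed
  have bound: "gaussian_bound b P X N V
      = log b (sqrt (det (cov_matrix P X) / det (cov_matrix P N) * (det (?gram (\<lambda>_. \<sigma>2) V) / det (?gram lam V))))"
    and pos: "0 < det (cov_matrix P X)" "0 < det (cov_matrix P N)" "0 < det (?gram (\<lambda>_. \<sigma>2) V)" "0 < det (?gram lam V)"
    if V: "invertible V" for V
  proof -
    note GX = gaussian_cond_entropy_coords[OF \<open>prob_space P\<close> b X FX V, folded SX_def, unfolded SX1]
    note GN = gaussian_cond_entropy_coords[OF \<open>prob_space P\<close> b N invFN FN V, folded SN_def, unfolded SN1]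
    have nz: "det V \<noteq> 0" using V by (simp add: invertible_det_nz)
    have det: "det (SX V) = (det V)\<^sup>2 * det (cov_matrix P X)" "det (SN V) = (det V)\<^sup>2 * det (cov_matrix P N)"
      by (simp_all add: SX_def SN_def det_mul power2_eq_square)
    show pos: "0 < det (cov_matrix P X)" "0 < det (cov_matrix P N)" "0 < det (?gram (\<lambda>_. \<sigma>2) V)" "0 < det (?gram lam V)"
      using GX(2,3) GN(2,3) nz by (auto simp: det zero_less_mult_iff)
    have "gaussian_bound b P X N V = log b (sqrt (det (SX V) / det (?gram lam V))) - log b (sqrt (det (SN V) / det (?gram (\<lambda>_. \<sigma>2) V)))"
      unfolding gaussian_bound_def GX(1) GN(1) by simp
    also have "\<dots> = log b (sqrt (det (SX V) / det (?gram lam V)) / sqrt (det (SN V) / det (?gram (\<lambda>_. \<sigma>2) V)))"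
      using GX(2,3) GN(2,3) b by (subst log_divide) auto
    also have "sqrt (det (SX V) / det (?gram lam V)) / sqrt (det (SN V) / det (?gram (\<lambda>_. \<sigma>2) V))
      = sqrt (det (cov_matrix P X) / det (cov_matrix P N) * (det (?gram (\<lambda>_. \<sigma>2) V) / det (?gram lam V)))"
      unfolding real_sqrt_divide[symmetric] det using nz pos by (simp add: field_simps)
    finally show "gaussian_bound b P X N V
      = log b (sqrt (det (cov_matrix P X) / det (cov_matrix P N) * (det (?gram (\<lambda>_. \<sigma>2) V) / det (?gram lam V))))" .
  qed
  \<comment> \<open>For \<open>V = W\<close> the columns in \<open>B\<close> are unit vectors, so
    the Gram matrix is diagonal with the leading weights: the case of equality in the determinant
    bound.\<close>
  have gramW: "det (?gram l W) = (\<Prod>i\<in>UNIV. l (Inl i))" for l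
  proof -
    have "?gram l W = (\<chi> i j. if i = j then l (Inl i) else 0)"
      by (auto simp: vec_eq_iff B_def WW mat_def if_distrib[of "\<lambda>t. _ * t"] if_distrib[of "\<lambda>t. t * _"] sum_UNIV_sum cong: if_cong)
    then show ?thesis by (simp add: det_diagonal)
  qed
  have "det (?gram lam V) \<le> (\<Prod>i\<in>UNIV. lam (Inl i)) * det (\<chi> i j. \<Sum>k\<in>UNIV. B V $ k $ i * B V $ k $ j :: real^'m^'m)"
    by (rule det_weighted_gram_le) (auto intro: less_imp_le[OF lam_pos] ord)
  then have "\<sigma>2 ^ CARD('m) * det (?gram lam V) \<le> (\<Prod>i\<in>UNIV. lam (Inl i)) * det (?gram (\<lambda>_. \<sigma>2) V)"
    using \<sigma>2_pos unfolding det_const_weighted_gram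
    by (simp add: mult.left_commute)
  then have "det (?gram (\<lambda>_. \<sigma>2) W) / det (?gram lam W) \<le> det (?gram (\<lambda>_. \<sigma>2) V) / det (?gram lam V)"
    unfolding gramW using pos(4)[OF V] lam_pos by (simp add: field_simps prod_pos)
  then have "det (cov_matrix P X) / det (cov_matrix P N) * (det (?gram (\<lambda>_. \<sigma>2) W) / det (?gram lam W))
      \<le> det (cov_matrix P X) / det (cov_matrix P N) * (det (?gram (\<lambda>_. \<sigma>2) V) / det (?gram lam V))"
    using pos(1,2)[OF V] by (intro mult_left_mono) auto
  then show ?thesis
    unfolding bound[OF V] bound[OF invW] using b pos[OF V] pos[OF invW]
    by (subst log_le_cancel_iff) auto
qed

section \<open>Mutual information with a finite quantization\<close>

lemma measurable_quantize:
  assumes "finite Q" "Q \<subseteq> sets borel" "partition_on UNIV Q"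
  shows "quantize Q \<in> borel \<rightarrow>\<^sub>M count_space Q"
proof -
  have eq: "quantize Q s = A" if "A \<in> Q" "s \<in> A" for s A
    unfolding quantize_def
  proof (rule the_equality)
    fix B assume "B \<in> Q \<and> s \<in> B"
    then show "B = A"
      using assms(3) that by (auto simp: partition_on_def disjoint_def)
  qed (use that in simp)
  have ex: "\<exists>A\<in>Q. s \<in> A" for s
    using assms(3) by (auto simp: partition_on_def)
  have "quantize Q -` {A} \<inter> space borel = A" if "A \<in> Q" for A
    using eq ex that by fastforce
  moreover have "quantize Q s \<in> Q" for s
    using eq ex by metis
  ultimately show ?thesis
    using assms by (auto simp: measurable_count_space_eq2)
qed

text \<open>A law puts no mass where its density vanishes. This is what allows logarithms of
  quotients of densities to be split almost surely.\<close>

lemma (in prob_space) distributed_AE_pos: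
  assumes f: "distributed M N X (\<lambda>x. ennreal (f x))"
  shows "AE \<omega> in M. 0 < f (X \<omega>)"
proof -
  have [measurable]: "X \<in> M \<rightarrow>\<^sub>M N" "(\<lambda>x. ennreal (f x)) \<in> borel_measurable N"
    using f by (auto simp: distributed_def)
  have "AE x in density N (\<lambda>x. ennreal (f x)). 0 < f x"
    by (auto simp: AE_density)
  then have "AE x in distr M N X. 0 < f x"
    unfolding distributed_distr_eq_density[OF f] .
  then show ?thesis by (rule AE_distrD[rotated]) simp
qed

text \<open>The law is finite, so its Radon-Nikodym derivative is finite almost everywhere and
  \<open>enn2real\<close> changes it on a null set only.\<close>

lemma (in prob_space) distributed_enn2real_RN_deriv:
  assumes "sigma_finite_measure N" and [measurable]: "X \<in> M \<rightarrow>\<^sub>M N"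
    and ac: "absolutely_continuous N (distr M N X)"
  shows "distributed M N X (\<lambda>x. ennreal (enn2real (RN_deriv N (distr M N X) x)))"
proof -
  interpret N: sigma_finite_measure N by fact
  interpret D: prob_space "distr M N X" by (rule prob_space_distr) simp
  have fin: "AE x in N. RN_deriv N (distr M N X) x \<noteq> \<infinity>"
    by (rule N.RN_deriv_finite[OF D.sigma_finite_measure_axioms ac]) simp
  have "density N (\<lambda>x. ennreal (enn2real (RN_deriv N (distr M N X) x))) = density N (RN_deriv N (distr M N X))"
    using fin by (intro density_cong) (auto simp: less_top elim!: eventually_mono)
  also have "\<dots> = distr M N X"
    by (rule N.density_RN_deriv[OF ac]) simp
  finally show ?thesis by (simp add: distributed_def)
qed

text \<open>A regular version \<open>r a x\<close> of \<open>P(T = a | X = x)\<close> for a finitely valued \<open>T\<close>.\<close>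

lemma (in prob_space) posterior_exists:
  assumes Q: "finite Q" and T[measurable]: "T \<in> M \<rightarrow>\<^sub>M count_space Q" and X[measurable]: "X \<in> M \<rightarrow>\<^sub>M K"
  obtains r :: "'q \<Rightarrow> 'x \<Rightarrow> real"
  where "\<And>a. r a \<in> borel_measurable K" "\<And>a x. 0 \<le> r a x" "\<And>a x. r a x \<le> 1"
    "\<And>a A. a \<in> Q \<Longrightarrow> A \<in> sets K \<Longrightarrow>
      (\<integral>\<^sup>+\<omega>. ennreal (r a (X \<omega>)) * indicator A (X \<omega>) \<partial>M) = emeasure M {\<omega> \<in> space M. T \<omega> = a \<and> X \<omega> \<in> A}"
proof -
  let ?\<mu> = "distr M K X"
  interpret mu: prob_space ?\<mu> by (rule prob_space_distr) simp
  let ?P = "\<lambda>a f. f \<in> borel_measurable K \<and> (\<forall>x. 0 \<le> f x) \<and> (\<forall>x. f x \<le> 1) \<and> (a \<in> Q \<longrightarrow>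
      (\<forall>A\<in>sets K. (\<integral>\<^sup>+\<omega>. ennreal (f (X \<omega>)) * indicator A (X \<omega>) \<partial>M) = emeasure M {\<omega> \<in> space M. T \<omega> = a \<and> X \<omega> \<in> A}))"
  have "\<exists>f. ?P a f" for a
  proof (cases "a \<in> Q")
    case False
    \<comment> \<open>Values outside \<open>Q\<close> get the default 0, so that measurability and
      the bounds hold for every \<open>a\<close>.\<close>
    then have "?P a (\<lambda>_. 0)" by simp
    then show ?thesis by blast
  next
    case True
    \<comment> \<open>The law of \<open>X\<close> restricted to the event \<open>T = a\<close>. It
      is dominated by the law of \<open>X\<close>, and the posterior is its derivative.\<close>
    define \<nu> where "\<nu> = distr (density M (indicator {\<omega> \<in> space M. T \<omega> = a})) K X"
    have [measurable]: "{\<omega> \<in> space M. T \<omega> = a} \<in> sets M"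
      using measurable_sets[OF T, of "{a}"] True by (simp add: vimage_def Int_def conj_commute)
    have nu: "emeasure \<nu> A = emeasure M {\<omega> \<in> space M. T \<omega> = a \<and> X \<omega> \<in> A}" if A[measurable]: "A \<in> sets K" for A
    proof -
      have "emeasure \<nu> A = emeasure M ({\<omega> \<in> space M. T \<omega> = a} \<inter> (X -` A \<inter> space M))"
        unfolding \<nu>_def by (subst emeasure_distr) (auto simp: emeasure_restricted)
      also have "{\<omega> \<in> space M. T \<omega> = a} \<inter> (X -` A \<inter> space M) = {\<omega> \<in> space M. T \<omega> = a \<and> X \<omega> \<in> A}" by auto
      finally show ?thesis .
    qed
    have le: "emeasure \<nu> A \<le> emeasure ?\<mu> A" if A[measurable]: "A \<in> sets K" for A
      unfolding nu[OF A] by (subst emeasure_distr) (auto intro!: emeasure_mono)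
    have [measurable_cong, simp]: "sets \<nu> = sets K" by (simp add: \<nu>_def)
    have ac: "absolutely_continuous ?\<mu> \<nu>"
      unfolding absolutely_continuous_def
    proof
      fix A assume "A \<in> null_sets ?\<mu>"
      then have "A \<in> sets K" "emeasure ?\<mu> A = 0" by auto
      then show "A \<in> null_sets \<nu>" using le[of A] by auto
    qed
    let ?f = "RN_deriv ?\<mu> \<nu>"
    have dens: "density ?\<mu> ?f = \<nu>" by (rule mu.density_RN_deriv[OF ac]) simp
    \<comment> \<open>On the set where the derivative exceeds 1, the excess integrates to a
      difference of measures that truncated subtraction makes 0, by domination.\<close>
    have f_le: "AE x in ?\<mu>. ?f x \<le> 1"
    proof -
      let ?B = "{x \<in> space K. 1 < ?f x}"
      have B[measurable]: "?B \<in> sets K" by measurable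
      have "(\<integral>\<^sup>+x. (?f x - 1) * indicator ?B x \<partial>?\<mu>) = (\<integral>\<^sup>+x. ?f x * indicator ?B x - indicator ?B x \<partial>?\<mu>)"
        by (intro nn_integral_cong) (auto simp: indicator_def)
      also have "\<dots> = (\<integral>\<^sup>+x. ?f x * indicator ?B x \<partial>?\<mu>) - (\<integral>\<^sup>+x. indicator ?B x \<partial>?\<mu>)"
      proof (rule nn_integral_diff)
        show "(\<integral>\<^sup>+x. indicator ?B x \<partial>?\<mu>) \<noteq> \<infinity>"
          by (subst nn_integral_indicator) (simp_all add: mu.emeasure_eq_measure del: emeasure_distr)
      qed (auto split: split_indicator)
      also have "\<dots> = emeasure \<nu> ?B - emeasure ?\<mu> ?B"
        by (subst dens[symmetric], subst emeasure_density) auto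
      also have "\<dots> = 0"
      proof -
        have "emeasure ?\<mu> ?B < \<infinity>" using mu.emeasure_finite[of ?B] by (simp only: less_top infinity_ennreal_def)
        then have "emeasure \<nu> ?B < \<infinity>" using le[OF B] by (rule le_less_trans[rotated])
        then show ?thesis using le[OF B] by (simp add: diff_eq_0_iff_ennreal)
      qed
      finally have "AE x in ?\<mu>. (?f x - 1) * indicator ?B x = 0"
        by (subst (asm) nn_integral_0_iff_AE) auto
      with AE_space show ?thesis
      proof eventually_elim
        case (elim x)
        show ?case
        proof (rule ccontr)
          assume "\<not> ?f x \<le> 1"
          then have "1 < ?f x" by simp
          moreover from this elim have "?f x - 1 = 0" by (simp add: indicator_def)
          ultimately show False by (metis ennreal_minus_eq_0 not_less)
        qed
      qed
    qed
    \<comment> \<open>The truncation turns an almost-everywhere bound into one at every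
      point.\<close>
    define f where "f x = min 1 (enn2real (?f x))" for x
    have [measurable]: "f \<in> borel_measurable K" unfolding f_def by measurable
    have "AE x in ?\<mu>. ennreal (f x) = ?f x"
      using f_le
    proof eventually_elim
      case (elim x)
      then have "enn2real (?f x) \<le> 1" and "?f x < top"
        by (auto intro: enn2real_leI order_le_less_trans[OF _ ennreal_one_less_top])
      then show ?case by (simp add: f_def)
    qed
    then have "density ?\<mu> (\<lambda>x. ennreal (f x)) = density ?\<mu> ?f"
      by (intro density_cong) auto
    then have eq: "density ?\<mu> (\<lambda>x. ennreal (f x)) = \<nu>"
      by (simp only: dens)
    have "(\<integral>\<^sup>+\<omega>. ennreal (f (X \<omega>)) * indicator A (X \<omega>) \<partial>M) = emeasure M {\<omega> \<in> space M. T \<omega> = a \<and> X \<omega> \<in> A}"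
      if A[measurable]: "A \<in> sets K" for A
      unfolding nu[OF A, symmetric] eq[symmetric]
      by (subst emeasure_density) (auto simp: nn_integral_distr)
    then have "?P a f" by (auto simp: f_def)
    then show ?thesis by blast
  qed
  then have "\<exists>r. \<forall>a. ?P a (r a)" by (intro choice allI)
  then obtain r where r: "\<forall>a. ?P a (r a)" ..
  show thesis
  proof (rule that[of r])
    fix a
    from r[THEN spec, of a] show "r a \<in> borel_measurable K" by (rule conjunct1)
    fix x
    from r[THEN spec, of a] show "0 \<le> r a x" "r a x \<le> 1" by simp_all
  next
    fix a A assume "a \<in> Q" "A \<in> sets K"
    with r[THEN spec, of a]
    show "(\<integral>\<^sup>+\<omega>. ennreal (r a (X \<omega>)) * indicator A (X \<omega>) \<partial>M) = emeasure M {\<omega> \<in> space M. T \<omega> = a \<and> X \<omega> \<in> A}"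
      by simp
  qed
qed

text \<open>With the law of \<open>X\<close> itself as reference measure, the posterior is the joint
  density whatever that law is. A joint event is the finite disjoint union of its slices over
  \<open>Q\<close>.\<close>

lemma (in prob_space) posterior_distributed:
  fixes r :: "'q \<Rightarrow> 'x \<Rightarrow> real"
  assumes Q: "finite Q" and T[measurable]: "T \<in> M \<rightarrow>\<^sub>M count_space Q" and X[measurable]: "X \<in> M \<rightarrow>\<^sub>M K"
    and r[measurable]: "\<And>a. r a \<in> borel_measurable K"
    and post: "\<And>a A. a \<in> Q \<Longrightarrow> A \<in> sets K \<Longrightarrow>
      (\<integral>\<^sup>+\<omega>. ennreal (r a (X \<omega>)) * indicator A (X \<omega>) \<partial>M) = emeasure M {\<omega> \<in> space M. T \<omega> = a \<and> X \<omega> \<in> A}"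
  shows "distributed M (count_space Q \<Otimes>\<^sub>M distr M K X) (\<lambda>\<omega>. (T \<omega>, X \<omega>)) (\<lambda>z. ennreal (r (fst z) (snd z)))"
proof -
  let ?\<mu> = "distr M K X" and ?P = "count_space Q \<Otimes>\<^sub>M distr M K X"
  interpret mu: prob_space ?\<mu> by (rule prob_space_distr) simp
  have sets: "sets ?P = sets (count_space Q \<Otimes>\<^sub>M K)" by (rule sets_pair_measure_cong) auto
  have [measurable]: "(\<lambda>z. r (fst z) (snd z)) \<in> borel_measurable ?P"
    unfolding measurable_cong_sets[OF sets refl]
    using Q by (intro measurable_pair_measure_countable1) (auto simp: countable_finite)
  have "distr M ?P (\<lambda>\<omega>. (T \<omega>, X \<omega>)) = density ?P (\<lambda>z. ennreal (r (fst z) (snd z)))"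
  proof (rule measure_eqI)
    fix E assume "E \<in> sets (distr M ?P (\<lambda>\<omega>. (T \<omega>, X \<omega>)))"
    then have E[measurable]: "E \<in> sets ?P" by simp
    have slice: "Pair a -` E \<in> sets K" for a
      using sets_Pair1[OF E, of a] by simp
    have T_in: "T \<omega> \<in> Q" if "\<omega> \<in> space M" for \<omega>
      using measurable_space[OF T that] by simp
    have ms: "{\<omega> \<in> space M. T \<omega> = a \<and> X \<omega> \<in> Pair a -` E} \<in> sets M" if "a \<in> Q" for a
    proof -
      have "T -` {a} \<inter> space M \<inter> (X -` (Pair a -` E) \<inter> space M) \<in> sets M"
        using that by (intro sets.Int measurable_sets[OF T] measurable_sets[OF X] slice) auto
      also have "T -` {a} \<inter> space M \<inter> (X -` (Pair a -` E) \<inter> space M) = {\<omega> \<in> space M. T \<omega> = a \<and> X \<omega> \<in> Pair a -` E}" by auto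
      finally show ?thesis .
    qed
    have "emeasure (distr M ?P (\<lambda>\<omega>. (T \<omega>, X \<omega>))) E = emeasure M (\<Union>a\<in>Q. {\<omega> \<in> space M. T \<omega> = a \<and> X \<omega> \<in> Pair a -` E})"
      by (subst emeasure_distr) (auto intro!: arg_cong[where f="emeasure M"] dest: T_in)
    also have "\<dots> = (\<Sum>a\<in>Q. emeasure M {\<omega> \<in> space M. T \<omega> = a \<and> X \<omega> \<in> Pair a -` E})"
      using ms Q by (intro sum_emeasure[symmetric]) (auto simp: disjoint_family_on_def)
    also have "\<dots> = (\<Sum>a\<in>Q. \<integral>\<^sup>+x. ennreal (r a x) * indicator (Pair a -` E) x \<partial>?\<mu>)"
    proof (intro sum.cong refl)
      fix a assume "a \<in> Q"
      have "(\<integral>\<^sup>+x. ennreal (r a x) * indicator (Pair a -` E) x \<partial>?\<mu>) = (\<integral>\<^sup>+\<omega>. ennreal (r a (X \<omega>)) * indicator (Pair a -` E) (X \<omega>) \<partial>M)"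
        using slice[of a] by (intro nn_integral_distr) auto
      then show "emeasure M {\<omega> \<in> space M. T \<omega> = a \<and> X \<omega> \<in> Pair a -` E} = (\<integral>\<^sup>+x. ennreal (r a x) * indicator (Pair a -` E) x \<partial>?\<mu>)"
        using post[OF \<open>a \<in> Q\<close> slice] by simp
    qed
    also have "\<dots> = (\<integral>\<^sup>+a. \<integral>\<^sup>+x. ennreal (r a x) * indicator E (a, x) \<partial>?\<mu> \<partial>count_space Q)"
      using Q by (simp add: nn_integral_count_space_finite indicator_vimage)
    also have "\<dots> = (\<integral>\<^sup>+z. ennreal (r (fst z) (snd z)) * indicator E z \<partial>?P)"
      using mu.nn_integral_fst[of "\<lambda>z. ennreal (r (fst z) (snd z)) * indicator E z" "count_space Q"] by simp
    finally show "emeasure (distr M ?P (\<lambda>\<omega>. (T \<omega>, X \<omega>))) E = emeasure (density ?P (\<lambda>z. ennreal (r (fst z) (snd z)))) E"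
      by (simp add: emeasure_density)
  qed simp
  then show ?thesis by (simp add: distributed_def)
qed

text \<open>Multiply \<open>ln (1 / u) \<le> 1 / u - 1\<close> by \<open>u\<close>. The bound makes
  the integrand of the mutual information integrable over a finite measure.\<close>

lemma abs_mult_ln_le_1:
  fixes u :: real
  assumes "0 \<le> u" "u \<le> 1"
  shows "\<bar>u * ln u\<bar> \<le> 1"
proof (cases "u = 0")
  case False
  with assms have u: "0 < u" by simp
  have "ln (1 / u) \<le> 1 / u - 1" using u by (intro ln_le_minus_one) simp
  then have "u * ln (1 / u) \<le> u * (1 / u - 1)" using u by (intro mult_left_mono) auto
  then have "- (u * ln u) \<le> 1" using u by (simp add: ln_div right_diff_distrib)
  moreover have "u * ln u \<le> 0" using u assms by (simp add: mult_le_0_iff)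
  ultimately show ?thesis by simp
qed simp

text \<open>The second expectation depends on \<open>T\<close> alone, so it drops out when the
  informations carried by \<open>X\<close> and by its head are subtracted. Finiteness of
  \<open>Q\<close> keeps both expectations finite.\<close>

lemma (in information_space) mutual_information_posterior:
  fixes r :: "'q \<Rightarrow> 'x \<Rightarrow> real"
  assumes Q: "finite Q" and T[measurable]: "T \<in> M \<rightarrow>\<^sub>M count_space Q" and X[measurable]: "X \<in> M \<rightarrow>\<^sub>M K"
    and r[measurable]: "\<And>a. r a \<in> borel_measurable K" and r_nn: "\<And>a x. 0 \<le> r a x" and r_le: "\<And>a x. r a x \<le> 1"
    and post: "\<And>a A. a \<in> Q \<Longrightarrow> A \<in> sets K \<Longrightarrow>
      (\<integral>\<^sup>+\<omega>. ennreal (r a (X \<omega>)) * indicator A (X \<omega>) \<partial>M) = emeasure M {\<omega> \<in> space M. T \<omega> = a \<and> X \<omega> \<in> A}"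
  shows "AE \<omega> in M. 0 < r (T \<omega>) (X \<omega>)"
    and "integrable M (\<lambda>\<omega>. log b (r (T \<omega>) (X \<omega>)))"
    and "mutual_information b (count_space Q) K T X
      = expectation (\<lambda>\<omega>. log b (r (T \<omega>) (X \<omega>))) - expectation (\<lambda>\<omega>. log b (prob {\<omega>' \<in> space M. T \<omega>' = T \<omega>}))"
proof -
  let ?\<mu> = "distr M K X" and ?P = "count_space Q \<Otimes>\<^sub>M distr M K X"
  let ?r = "\<lambda>z. r (fst z) (snd z)"
  interpret mu: prob_space ?\<mu> by (rule prob_space_distr) simp
  interpret cs: finite_measure "count_space Q" by (rule finite_measure_count_space[OF Q])
  interpret P: finite_measure ?P by (rule finite_measure_pair_measure) unfold_locales
  have joint: "distributed M ?P (\<lambda>\<omega>. (T \<omega>, X \<omega>)) (\<lambda>z. ennreal (?r z))"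
    by (rule posterior_distributed[OF Q T X r post])
  have r_meas[measurable]: "?r \<in> borel_measurable ?P"
    by (rule distributed_real_measurable[OF _ joint]) (simp add: r_nn)
  show pos: "AE \<omega> in M. 0 < r (T \<omega>) (X \<omega>)"
    using distributed_AE_pos[OF joint] by simp
  have int_bounded: "integrable ?P (\<lambda>z. ?r z * log b (?r z))"
  proof (rule P.integrable_const_bound[where B="1 / ln b"])
    have "\<bar>u * log b u\<bar> \<le> 1 / ln b" if "0 \<le> u" "u \<le> 1" for u
      using divide_right_mono[OF abs_mult_ln_le_1[OF that], of "ln b"] b_gt_1 by (simp add: log_def abs_mult)
    then show "AE z in ?P. norm (?r z * log b (?r z)) \<le> 1 / ln b"
      using r_nn r_le by simp
  qed measurable
  show int: "integrable M (\<lambda>\<omega>. log b (r (T \<omega>) (X \<omega>)))"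
  proof -
    have "integrable (distr M ?P (\<lambda>\<omega>. (T \<omega>, X \<omega>))) (\<lambda>z. log b (?r z))"
      unfolding distributed_distr_eq_density[OF joint]
      using int_bounded by (subst integrable_real_density) (auto simp: r_nn)
    then show ?thesis
      by (subst (asm) integrable_distr_eq) (auto intro: distributed_measurable[OF joint])
  qed
  let ?p = "\<lambda>a. prob {\<omega> \<in> space M. T \<omega> = a}"
  have margT: "distributed M (count_space Q) T (\<lambda>a. ennreal (?p a))"
    unfolding distributed_def
  proof (intro conjI T)
    show "distr M (count_space Q) T = density (count_space Q) (\<lambda>a. ennreal (?p a))"
    proof (rule measure_eqI_finite[of _ Q])
      fix a assume a: "a \<in> Q"
      then have "{x. x = a \<and> x \<in> Q} = {a}" by auto
      with a show "emeasure (distr M (count_space Q) T) {a} = emeasure (density (count_space Q) (\<lambda>a. ennreal (?p a))) {a}"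
        using Q by (simp add: emeasure_distr emeasure_density emeasure_eq_measure nn_integral_count_space_finite
            indicator_def if_distrib[of "\<lambda>t. _ * t"] vimage_def Int_def conj_commute cong: if_cong)
    qed (use Q in auto)
  qed simp
  have margX: "distributed M ?\<mu> X (\<lambda>_. ennreal 1)"
  proof -
    have "distr M ?\<mu> X = ?\<mu>" by (rule distr_cong) auto
    then show ?thesis by (simp add: distributed_def density_1)
  qed
  have p_fst[measurable]: "(\<lambda>z. ?p (fst z)) \<in> borel_measurable ?P"
    by (rule measurable_compose[OF measurable_fst]) simp
  have posT: "AE \<omega> in M. 0 < ?p (T \<omega>)"
    by (rule distributed_AE_pos[OF margT])
  have intT: "integrable M (\<lambda>\<omega>. log b (?p (T \<omega>)))"
  proof -
    have "integrable (distr M (count_space Q) T) (\<lambda>a. log b (?p a))"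
      unfolding distributed_distr_eq_density[OF margT] using Q
      by (subst integrable_real_density) (auto intro: integrable_count_space)
    then show ?thesis by (subst (asm) integrable_distr_eq) auto
  qed
  \<comment> \<open>\<open>mutual_information\<close> sees a reference measure only through its
    measurable sets, so \<open>K\<close> may be exchanged for the law of \<open>X\<close>, relative
    to which \<open>X\<close> has density 1.\<close>
  have "mutual_information b (count_space Q) K T X = mutual_information b (count_space Q) ?\<mu> T X"
  proof -
    have "distr M ?\<mu> X = distr M K X" by (rule distr_cong) auto
    moreover have "distr M ?P (\<lambda>\<omega>. (T \<omega>, X \<omega>)) = distr M (count_space Q \<Otimes>\<^sub>M K) (\<lambda>\<omega>. (T \<omega>, X \<omega>))"
      by (rule distr_cong) (auto intro!: sets_pair_measure_cong)
    ultimately show ?thesis by (simp add: mutual_information_def)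
  qed
  also have "\<dots> = (\<integral>z. ?r z * log b (?r z / (?p (fst z) * 1)) \<partial>?P)"
    by (rule mutual_information_distr[OF _ _ margT _ margX _ joint])
      (auto simp: r_nn intro: cs.sigma_finite_measure_axioms mu.sigma_finite_measure_axioms)
  also have "\<dots> = expectation (\<lambda>\<omega>. log b (?r (T \<omega>, X \<omega>) / (?p (fst (T \<omega>, X \<omega>)) * 1)))"
  proof (rule distributed_integral[OF joint])
    show "(\<lambda>z. log b (?r z / (?p (fst z) * 1))) \<in> borel_measurable ?P"
      by (intro borel_measurable_log borel_measurable_divide borel_measurable_times borel_measurable_const r_meas p_fst)
  qed (simp add: r_nn)
  also have "\<dots> = expectation (\<lambda>\<omega>. log b (r (T \<omega>) (X \<omega>)) - log b (?p (T \<omega>)))"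
  proof (rule integral_cong_AE)
    show "AE \<omega> in M. log b (?r (T \<omega>, X \<omega>) / (?p (fst (T \<omega>, X \<omega>)) * 1)) = log b (r (T \<omega>) (X \<omega>)) - log b (?p (T \<omega>))"
      using pos posT by eventually_elim (simp add: log_divide)
    have "(\<lambda>\<omega>. ?r (T \<omega>, X \<omega>)) \<in> borel_measurable M"
      by (rule measurable_compose[OF distributed_measurable[OF joint] r_meas])
    moreover have "(\<lambda>\<omega>. ?p (T \<omega>)) \<in> borel_measurable M"
      by (rule measurable_compose[OF T]) simp
    ultimately show "(\<lambda>\<omega>. log b (?r (T \<omega>, X \<omega>) / (?p (fst (T \<omega>, X \<omega>)) * 1))) \<in> borel_measurable M"
      "(\<lambda>\<omega>. log b (r (T \<omega>) (X \<omega>)) - log b (?p (T \<omega>))) \<in> borel_measurable M"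
      by simp_all
  qed
  also have "\<dots> = expectation (\<lambda>\<omega>. log b (r (T \<omega>) (X \<omega>))) - expectation (\<lambda>\<omega>. log b (?p (T \<omega>)))"
    by (rule Bochner_Integration.integral_diff[OF int intT])
  finally show "mutual_information b (count_space Q) K T X
      = expectation (\<lambda>\<omega>. log b (r (T \<omega>) (X \<omega>))) - expectation (\<lambda>\<omega>. log b (?p (T \<omega>)))" .
qed

section \<open>The loss of relevant information\<close>

text \<open>The joint density already yields a marginal one, because cylinders over null sets are
  null. The entropy then becomes an expectation of logarithms of real-valued densities.\<close>

lemma (in information_space) cond_diff_entropy_finiteD:
  fixes A :: "'a \<Rightarrow> real^'c" and B :: "'a \<Rightarrow> real^'m"
  assumes [measurable]: "A \<in> borel_measurable M" "B \<in> borel_measurable M"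
    and fin: "cond_diff_entropy_finite b M A B"
  obtains p :: "(real^'c) \<times> (real^'m) \<Rightarrow> real" and q :: "real^'m \<Rightarrow> real"
  where "p \<in> borel_measurable (lborel \<Otimes>\<^sub>M lborel)" "q \<in> borel_measurable borel" "\<And>z. 0 \<le> p z" "\<And>y. 0 \<le> q y"
    "distributed M (lborel \<Otimes>\<^sub>M lborel) (\<lambda>\<omega>. (A \<omega>, B \<omega>)) (\<lambda>z. ennreal (p z))"
    "distributed M lborel B (\<lambda>y. ennreal (q y))"
    "integrable M (\<lambda>\<omega>. log b (p (A \<omega>, B \<omega>) / q (B \<omega>)))"
    "cond_diff_entropy b M A B = - expectation (\<lambda>\<omega>. log b (p (A \<omega>, B \<omega>) / q (B \<omega>)))"
proof -
  let ?L = "lborel \<Otimes>\<^sub>M lborel :: ((real^'c) \<times> (real^'m)) measure"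
  let ?D = "distr M ?L (\<lambda>\<omega>. (A \<omega>, B \<omega>))"
  have ac: "absolutely_continuous ?L ?D"
    and int: "integrable ?D (\<lambda>(x, y). log b (enn2real (RN_deriv ?L ?D (x, y)) / enn2real (RN_deriv lborel (distr M lborel B) y)))"
    using fin by (auto simp: cond_diff_entropy_finite_def)
  have ac': "absolutely_continuous lborel (distr M lborel B)"
    unfolding absolutely_continuous_def
  proof
    fix E :: "(real^'m) set" assume E: "E \<in> null_sets lborel"
    then have [measurable]: "E \<in> sets borel" by auto
    have "UNIV \<times> E \<in> null_sets ?L"
      using E by (intro null_setsI) (simp_all add: lborel.emeasure_pair_measure_Times null_setsD1 del: borel_prod)
    then have "UNIV \<times> E \<in> null_sets ?D" using ac by (auto simp: absolutely_continuous_def)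
    then have "emeasure ?D (UNIV \<times> E) = 0" by auto
    then have "emeasure M (B -` E \<inter> space M) = 0"
      by (subst (asm) emeasure_distr) (auto simp: vimage_def)
    then show "E \<in> null_sets (distr M lborel B)"
      by (intro null_setsI) (simp_all add: emeasure_distr)
  qed
  let ?p = "\<lambda>z. enn2real (RN_deriv ?L ?D z)" and ?q = "\<lambda>y. enn2real (RN_deriv lborel (distr M lborel B) y)"
  have sf: "sigma_finite_measure ?L"
    by (rule lborel_pair.sigma_finite_measure_axioms)
  have meas: "(\<lambda>z. log b (?p z / ?q (snd z))) \<in> borel_measurable ?L" by measurable
  show thesis
  proof (rule that[of ?p ?q])
    show "distributed M ?L (\<lambda>\<omega>. (A \<omega>, B \<omega>)) (\<lambda>z. ennreal (?p z))"
      by (rule distributed_enn2real_RN_deriv[OF sf _ ac]) measurable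
    show "distributed M lborel B (\<lambda>y. ennreal (?q y))"
      by (rule distributed_enn2real_RN_deriv[OF lborel.sigma_finite_measure_axioms _ ac']) measurable
    have AB: "(\<lambda>\<omega>. (A \<omega>, B \<omega>)) \<in> M \<rightarrow>\<^sub>M ?L" by measurable
    show "integrable M (\<lambda>\<omega>. log b (?p (A \<omega>, B \<omega>) / ?q (B \<omega>)))"
      using int integrable_distr_eq[OF AB meas] by (simp add: split_beta')
    show "cond_diff_entropy b M A B = - expectation (\<lambda>\<omega>. log b (?p (A \<omega>, B \<omega>) / ?q (B \<omega>)))"
      using integral_distr[OF AB meas] by (simp add: conditional_entropy_def split_beta')
  qed auto
qed

lemma AE_lborel_translate:
  fixes c :: "'a::euclidean_space"
  assumes "AE x in lborel. P x" and "{x. P x} \<in> sets borel"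
  shows "AE x in lborel. P (c + x)"
proof -
  have "AE x in distr lborel borel ((+) c). P x" using assms(1) by (subst lborel_distr_plus)
  then show ?thesis using assms(2) by (subst (asm) AE_distr_iff) auto
qed

text \<open>Both sides are Lebesgue densities of the measure taking \<open>B\<close> to the
  probability of \<open>T = a\<close> and \<open>D\<close> in \<open>B\<close>, so they agree almost
  everywhere. The maps \<open>g\<close> and \<open>\<psi>\<close> express that \<open>D\<close> is a
  function of \<open>X\<close> and \<open>X\<close> one of \<open>(C, D)\<close>.\<close>

lemma (in prob_space) posterior_marginal:
  fixes r :: "'q \<Rightarrow> 'x \<Rightarrow> real" and rM :: "'q \<Rightarrow> 'y::euclidean_space \<Rightarrow> real"
    and C :: "'a \<Rightarrow> 'z::euclidean_space" and D :: "'a \<Rightarrow> 'y"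
  assumes C[measurable]: "C \<in> borel_measurable M" and D[measurable]: "D \<in> borel_measurable M"
    and X[measurable]: "X \<in> M \<rightarrow>\<^sub>M K"
    and g[measurable]: "g \<in> K \<rightarrow>\<^sub>M borel" and gX: "\<And>\<omega>. \<omega> \<in> space M \<Longrightarrow> D \<omega> = g (X \<omega>)"
    and \<psi>[measurable]: "\<psi> \<in> lborel \<Otimes>\<^sub>M lborel \<rightarrow>\<^sub>M K" and X\<psi>: "\<And>\<omega>. \<omega> \<in> space M \<Longrightarrow> X \<omega> = \<psi> (C \<omega>, D \<omega>)"
    and p: "distributed M (lborel \<Otimes>\<^sub>M lborel) (\<lambda>\<omega>. (C \<omega>, D \<omega>)) (\<lambda>z. ennreal (p z))" "\<And>z. 0 \<le> p z"
    and q: "distributed M lborel D (\<lambda>y. ennreal (q y))" "\<And>y. 0 \<le> q y"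
    and r[measurable]: "r a \<in> borel_measurable K" "\<And>x. 0 \<le> r a x"
    and rM[measurable]: "rM a \<in> borel_measurable borel" "\<And>y. 0 \<le> rM a y"
    and post: "\<And>A. A \<in> sets K \<Longrightarrow>
      (\<integral>\<^sup>+\<omega>. ennreal (r a (X \<omega>)) * indicator A (X \<omega>) \<partial>M) = emeasure M {\<omega> \<in> space M. T \<omega> = a \<and> X \<omega> \<in> A}"
    and postM: "\<And>A. A \<in> sets borel \<Longrightarrow>
      (\<integral>\<^sup>+\<omega>. ennreal (rM a (D \<omega>)) * indicator A (D \<omega>) \<partial>M) = emeasure M {\<omega> \<in> space M. T \<omega> = a \<and> D \<omega> \<in> A}"
  shows "AE y in lborel. (\<integral>\<^sup>+x. ennreal (r a (\<psi> (x, y)) * p (x, y)) \<partial>lborel) = ennreal (rM a y * q y)"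
proof -
  have [measurable]: "p \<in> borel_measurable (lborel \<Otimes>\<^sub>M lborel)"
    by (rule distributed_real_measurable[OF _ p(1)]) (rule p(2))
  have [measurable]: "q \<in> borel_measurable borel"
    using distributed_real_measurable[OF _ q(1)] q(2) by simp
  let ?G = "\<lambda>y. \<integral>\<^sup>+x. ennreal (r a (\<psi> (x, y)) * p (x, y)) \<partial>lborel"
  have G[measurable]: "?G \<in> borel_measurable borel"
  proof -
    have "(\<lambda>y. \<integral>\<^sup>+x. (\<lambda>(y, x). ennreal (r a (\<psi> (x, y)) * p (x, y))) (y, x) \<partial>lborel) \<in> borel_measurable lborel"
      by (rule lborel.borel_measurable_nn_integral_fst) measurable
    then show ?thesis by simp
  qed
  have "density lborel ?G = density lborel (\<lambda>y. ennreal (rM a y * q y))"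
  proof (rule measure_eqI)
    fix B :: "'y set" assume "B \<in> sets (density lborel ?G)"
    then have B[measurable]: "B \<in> sets borel" by simp
    have gB: "g -` B \<inter> space K \<in> sets K" by measurable
    have "emeasure (density lborel ?G) B = (\<integral>\<^sup>+y. \<integral>\<^sup>+x. ennreal (p (x, y)) * (ennreal (r a (\<psi> (x, y))) * indicator B y) \<partial>lborel \<partial>lborel)"
      proof (subst emeasure_density)
      show "(\<integral>\<^sup>+y. ?G y * indicator B y \<partial>lborel) = (\<integral>\<^sup>+y. \<integral>\<^sup>+x. ennreal (p (x, y)) * (ennreal (r a (\<psi> (x, y))) * indicator B y) \<partial>lborel \<partial>lborel)"
    proof (rule nn_integral_cong)
      fix y
      have "(\<integral>\<^sup>+x. ennreal (r a (\<psi> (x, y)) * p (x, y)) * indicator B y \<partial>lborel) = ?G y * indicator B y"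
        by (rule nn_integral_multc) measurable
      then show "?G y * indicator B y = (\<integral>\<^sup>+x. ennreal (p (x, y)) * (ennreal (r a (\<psi> (x, y))) * indicator B y) \<partial>lborel)"
        by (simp add: ennreal_mult p(2) r(2) mult_ac)
    qed
    qed simp_all
    also have "\<dots> = (\<integral>\<^sup>+z. ennreal (p z) * (ennreal (r a (\<psi> z)) * indicator B (snd z)) \<partial>(lborel \<Otimes>\<^sub>M lborel))"
      using lborel_pair.nn_integral_snd[of "\<lambda>z. ennreal (p z) * (ennreal (r a (\<psi> z)) * indicator B (snd z))"] by simp
    also have "\<dots> = (\<integral>\<^sup>+\<omega>. ennreal (r a (\<psi> (C \<omega>, D \<omega>))) * indicator B (snd (C \<omega>, D \<omega>)) \<partial>M)"
      by (rule distributed_nn_integral[OF p(1)]) measurable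
    also have "\<dots> = (\<integral>\<^sup>+\<omega>. ennreal (r a (X \<omega>)) * indicator (g -` B \<inter> space K) (X \<omega>) \<partial>M)"
      using measurable_space[OF X] by (intro nn_integral_cong) (auto simp: X\<psi>[symmetric] gX[symmetric] indicator_def)
    also have "\<dots> = emeasure M {\<omega> \<in> space M. T \<omega> = a \<and> X \<omega> \<in> g -` B \<inter> space K}"
      by (rule post[OF gB])
    also have "{\<omega> \<in> space M. T \<omega> = a \<and> X \<omega> \<in> g -` B \<inter> space K} = {\<omega> \<in> space M. T \<omega> = a \<and> D \<omega> \<in> B}"
      using measurable_space[OF X] by (auto simp: gX)
    also have "emeasure M \<dots> = (\<integral>\<^sup>+\<omega>. ennreal (rM a (D \<omega>)) * indicator B (D \<omega>) \<partial>M)"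
      by (rule postM[OF B, symmetric])
    also have "\<dots> = (\<integral>\<^sup>+y. ennreal (q y) * (ennreal (rM a y) * indicator B y) \<partial>lborel)"
      by (rule distributed_nn_integral[OF q(1), symmetric]) measurable
    also have "\<dots> = emeasure (density lborel (\<lambda>y. ennreal (rM a y * q y))) B"
      by (simp add: emeasure_density ennreal_mult rM(2) q(2) mult_ac)
    finally show "emeasure (density lborel ?G) B = emeasure (density lborel (\<lambda>y. ennreal (rM a y * q y))) B" .
  qed simp
  then show ?thesis
    by (intro sigma_finite_measure.density_unique[OF lborel.sigma_finite_measure_axioms]) auto
qed

text \<open>
  The integrand is \<open>g / f\<close>, where \<open>f\<close> and \<open>g\<close> are the conditional densities of \<open>Y\<^sub>c\<close> given
  \<open>(Y\<^sub>M, S)\<close> and given \<open>(Y\<^sub>M, T)\<close>, respectively.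
\<close>

lemma (in prob_space) density_ratio_le_1:
  fixes S :: "'a \<Rightarrow> 's::topological_space" and s1 :: "'s \<Rightarrow> 'z::euclidean_space" and s2 :: "'s \<Rightarrow> 'y::euclidean_space"
    and N1 :: "'a \<Rightarrow> 'z" and N2 :: "'a \<Rightarrow> 'y"
    and h :: "'q \<Rightarrow> 'z \<times> 'y \<Rightarrow> real" and k :: "'q \<Rightarrow> 'y \<Rightarrow> real"
  assumes S[measurable]: "S \<in> borel_measurable M"
    and law: "distr M (borel \<Otimes>\<^sub>M (lborel \<Otimes>\<^sub>M lborel)) (\<lambda>\<omega>. (S \<omega>, (N1 \<omega>, N2 \<omega>)))
      = distr M borel S \<Otimes>\<^sub>M distr M (lborel \<Otimes>\<^sub>M lborel) (\<lambda>\<omega>. (N1 \<omega>, N2 \<omega>))"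
    and s[measurable]: "s1 \<in> borel_measurable borel" "s2 \<in> borel_measurable borel"
    and Q: "finite Q" and t[measurable]: "t \<in> borel \<rightarrow>\<^sub>M count_space Q"
    and p: "distributed M (lborel \<Otimes>\<^sub>M lborel) (\<lambda>\<omega>. (N1 \<omega>, N2 \<omega>)) (\<lambda>z. ennreal (p z))" "\<And>z. 0 \<le> p z"
    and q: "distributed M lborel N2 (\<lambda>y. ennreal (q y))" "\<And>y. 0 \<le> q y"
    and h[measurable]: "\<And>a. h a \<in> borel_measurable (lborel \<Otimes>\<^sub>M lborel)" "\<And>a z. 0 \<le> h a z"
    and k[measurable]: "\<And>a. k a \<in> borel_measurable borel" "\<And>a y. 0 \<le> k a y"
    and hk: "\<And>a. a \<in> Q \<Longrightarrow> AE y in lborel. (\<integral>\<^sup>+x. ennreal (h a (x, y)) \<partial>lborel) = ennreal (k a y)"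
  defines "u \<equiv> \<lambda>(s, n). h (t s) (s1 s + fst n, s2 s + snd n) * q (snd n) / (k (t s) (s2 s + snd n) * p n)"
  shows "(\<lambda>\<omega>. u (S \<omega>, (N1 \<omega>, N2 \<omega>))) \<in> borel_measurable M"
    and "(\<integral>\<^sup>+\<omega>. ennreal (u (S \<omega>, (N1 \<omega>, N2 \<omega>))) \<partial>M) \<le> 1"
proof -
  let ?L = "lborel \<Otimes>\<^sub>M lborel :: ('z \<times> 'y) measure" and ?PS = "distr M borel S"
  have [measurable]: "p \<in> borel_measurable ?L"
    by (rule distributed_real_measurable[OF _ p(1)]) (rule p(2))
  have [measurable]: "q \<in> borel_measurable borel"
    using distributed_real_measurable[OF _ q(1)] q(2) by simp
  note total = emeasure_space_1
  have t_in: "t s \<in> Q" for s using measurable_space[OF t, of s] by simp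
  have N[measurable]: "(\<lambda>\<omega>. (N1 \<omega>, N2 \<omega>)) \<in> M \<rightarrow>\<^sub>M ?L" using p(1) by (simp add: distributed_def)
  \<comment> \<open>\<open>t\<close> takes finitely many values, so measurability can be checked for
    each fixed value.\<close>
  have [measurable]: "(\<lambda>x. h (t (fst x)) (s1 (fst x) + fst (snd x), s2 (fst x) + snd (snd x))) \<in> borel_measurable (borel \<Otimes>\<^sub>M ?L)"
  proof (rule measurable_compose_countable'[where I=Q and g="\<lambda>x. t (fst x)" and f="\<lambda>a x. h a (s1 (fst x) + fst (snd x), s2 (fst x) + snd (snd x))"])
    show "(\<lambda>x. h a (s1 (fst x) + fst (snd x), s2 (fst x) + snd (snd x))) \<in> borel_measurable (borel \<Otimes>\<^sub>M ?L)" for a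
      by measurable
  qed (use Q in \<open>auto simp: countable_finite\<close>)
  have [measurable]: "(\<lambda>x. k (t (fst x)) (s2 (fst x) + snd (snd x))) \<in> borel_measurable (borel \<Otimes>\<^sub>M ?L)"
  proof (rule measurable_compose_countable'[where I=Q and g="\<lambda>x. t (fst x)" and f="\<lambda>a x. k a (s2 (fst x) + snd (snd x))"])
    show "(\<lambda>x. k a (s2 (fst x) + snd (snd x))) \<in> borel_measurable (borel \<Otimes>\<^sub>M ?L)" for a
      by measurable
  qed (use Q in \<open>auto simp: countable_finite\<close>)
  have u[measurable]: "u \<in> borel_measurable (borel \<Otimes>\<^sub>M ?L)"
    unfolding u_def by (simp add: split_beta')
  show "(\<lambda>\<omega>. u (S \<omega>, (N1 \<omega>, N2 \<omega>))) \<in> borel_measurable M" by measurable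
  interpret PS: prob_space ?PS by (rule prob_space_distr) simp
  interpret PN: prob_space "distr M ?L (\<lambda>\<omega>. (N1 \<omega>, N2 \<omega>))" by (rule prob_space_distr) simp
  interpret pair_prob_space ?PS "distr M ?L (\<lambda>\<omega>. (N1 \<omega>, N2 \<omega>))" ..
  \<comment> \<open>For fixed \<open>s\<close> the noise density cancels. Integrating over the tail,
    translation invariance turns the shifted \<open>h\<close> into \<open>k\<close>, which cancels
    too, and \<open>q\<close> with total mass 1 remains. Both cancellations are inequalities, since
    division by 0 yields 0.\<close>
  have inner: "(\<integral>\<^sup>+n. ennreal (u (s, n)) \<partial>distr M ?L (\<lambda>\<omega>. (N1 \<omega>, N2 \<omega>))) \<le> 1" for s
  proof -
    let ?G = "\<lambda>y. \<integral>\<^sup>+x. ennreal (h (t s) (x, y)) \<partial>lborel"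
    have G[measurable]: "?G \<in> borel_measurable borel"
    proof -
      have "(\<lambda>y. \<integral>\<^sup>+x. (\<lambda>(y, x). ennreal (h (t s) (x, y))) (y, x) \<partial>lborel) \<in> borel_measurable lborel"
        by (rule lborel.borel_measurable_nn_integral_fst) measurable
      then show ?thesis by simp
    qed
    have "(\<integral>\<^sup>+n. ennreal (u (s, n)) \<partial>distr M ?L (\<lambda>\<omega>. (N1 \<omega>, N2 \<omega>))) = (\<integral>\<^sup>+n. ennreal (p n) * ennreal (u (s, n)) \<partial>?L)"
      unfolding distributed_distr_eq_density[OF p(1)] by (subst nn_integral_density) auto
    also have "\<dots> \<le> (\<integral>\<^sup>+n. ennreal (q (snd n) / k (t s) (s2 s + snd n)) * ennreal (h (t s) (s1 s + fst n, s2 s + snd n)) \<partial>?L)"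
    proof (rule nn_integral_mono)
      fix n
      show "ennreal (p n) * ennreal (u (s, n)) \<le> ennreal (q (snd n) / k (t s) (s2 s + snd n)) * ennreal (h (t s) (s1 s + fst n, s2 s + snd n))"
        using p(2)[of n] q(2) h(2) k(2)
        by (cases "p n = 0") (auto simp: u_def ennreal_mult[symmetric] mult.commute intro!: ennreal_leI)
    qed
    also have "\<dots> = (\<integral>\<^sup>+y. \<integral>\<^sup>+x. ennreal (q y / k (t s) (s2 s + y)) * ennreal (h (t s) (s1 s + x, s2 s + y)) \<partial>lborel \<partial>lborel)"
      by (subst lborel_pair.nn_integral_snd[symmetric]) auto
    also have "\<dots> = (\<integral>\<^sup>+y. ennreal (q y / k (t s) (s2 s + y)) * ?G (s2 s + y) \<partial>lborel)"
    proof (rule nn_integral_cong)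
      fix y
      have "(\<integral>\<^sup>+x. ennreal (h (t s) (s1 s + x, s2 s + y)) \<partial>lborel) = ?G (s2 s + y)"
        by (rule nn_integral_lborel_translate) measurable
      then show "(\<integral>\<^sup>+x. ennreal (q y / k (t s) (s2 s + y)) * ennreal (h (t s) (s1 s + x, s2 s + y)) \<partial>lborel)
        = ennreal (q y / k (t s) (s2 s + y)) * ?G (s2 s + y)"
        by (subst nn_integral_cmult) auto
    qed
    also have "\<dots> \<le> (\<integral>\<^sup>+y. ennreal (q y) \<partial>lborel)"
    proof (rule nn_integral_mono_AE)
      have "AE y in lborel. ?G (s2 s + y) = ennreal (k (t s) (s2 s + y))"
        by (rule AE_lborel_translate[OF hk[OF t_in]]) measurable
      then show "AE y in lborel. ennreal (q y / k (t s) (s2 s + y)) * ?G (s2 s + y) \<le> ennreal (q y)"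
      proof eventually_elim
        case (elim y)
        then show ?case
          using q(2)[of y] k(2)[of "t s" "s2 s + y"]
          by (cases "k (t s) (s2 s + y) = 0") (auto simp: ennreal_mult[symmetric])
      qed
    qed
    also have "\<dots> = emeasure (distr M lborel N2) (space lborel)"
      unfolding distributed_distr_eq_density[OF q(1)] by (simp add: emeasure_density)
    also have "\<dots> = 1"
      using q(1) by (subst emeasure_distr) (auto simp: distributed_def total)
    finally show ?thesis .
  qed
  have "(\<integral>\<^sup>+\<omega>. ennreal (u (S \<omega>, (N1 \<omega>, N2 \<omega>))) \<partial>M) = (\<integral>\<^sup>+x. ennreal (u x) \<partial>(?PS \<Otimes>\<^sub>M distr M ?L (\<lambda>\<omega>. (N1 \<omega>, N2 \<omega>))))"
    unfolding law[symmetric] by (subst nn_integral_distr) auto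
  also have "\<dots> = (\<integral>\<^sup>+s. \<integral>\<^sup>+n. ennreal (u (s, n)) \<partial>distr M ?L (\<lambda>\<omega>. (N1 \<omega>, N2 \<omega>)) \<partial>?PS)"
    by (rule PN.nn_integral_fst[symmetric]) measurable
  also have "\<dots> \<le> (\<integral>\<^sup>+s. 1 \<partial>?PS)"
    by (intro nn_integral_mono inner)
  also have "\<dots> = 1" using PS.emeasure_space_1 by simp
  finally show "(\<integral>\<^sup>+\<omega>. ennreal (u (S \<omega>, (N1 \<omega>, N2 \<omega>))) \<partial>M) \<le> 1" .
qed

text \<open>Here \<open>(C, D)\<close> stands for tail and head of \<open>X\<close> in the chosen
  coordinates. The tangent inequality \<open>log b u \<le> (u - 1) / ln b\<close> takes the place of
  Jensen's inequality in passing from the mean of \<open>U\<close> to that of its logarithm.\<close>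

proposition (in information_space) mutual_information_loss_le:
  fixes S :: "'a \<Rightarrow> 's::topological_space" and s1 :: "'s \<Rightarrow> real^'c" and s2 :: "'s \<Rightarrow> real^'m"
  assumes S[measurable]: "S \<in> borel_measurable M"
    and N1[measurable]: "N1 \<in> borel_measurable M" and N2[measurable]: "N2 \<in> borel_measurable M"
    and law: "distr M (borel \<Otimes>\<^sub>M (lborel \<Otimes>\<^sub>M lborel)) (\<lambda>\<omega>. (S \<omega>, (N1 \<omega>, N2 \<omega>)))
      = distr M borel S \<Otimes>\<^sub>M distr M (lborel \<Otimes>\<^sub>M lborel) (\<lambda>\<omega>. (N1 \<omega>, N2 \<omega>))"
    and s[measurable]: "s1 \<in> borel_measurable borel" "s2 \<in> borel_measurable borel"
    and C: "\<And>\<omega>. \<omega> \<in> space M \<Longrightarrow> C \<omega> = s1 (S \<omega>) + N1 \<omega>" and D: "\<And>\<omega>. \<omega> \<in> space M \<Longrightarrow> D \<omega> = s2 (S \<omega>) + N2 \<omega>"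
    and finN: "cond_diff_entropy_finite b M N1 N2" and finY: "cond_diff_entropy_finite b M C D"
    and X[measurable]: "X \<in> M \<rightarrow>\<^sub>M K"
    and g[measurable]: "g \<in> K \<rightarrow>\<^sub>M borel" and gX: "\<And>\<omega>. \<omega> \<in> space M \<Longrightarrow> D \<omega> = g (X \<omega>)"
    and \<psi>[measurable]: "\<psi> \<in> lborel \<Otimes>\<^sub>M lborel \<rightarrow>\<^sub>M K" and X\<psi>: "\<And>\<omega>. \<omega> \<in> space M \<Longrightarrow> X \<omega> = \<psi> (C \<omega>, D \<omega>)"
    and Q: "finite Q" and t[measurable]: "t \<in> borel \<rightarrow>\<^sub>M count_space Q"
  shows "mutual_information b (count_space Q) K (\<lambda>\<omega>. t (S \<omega>)) X - mutual_information b (count_space Q) borel (\<lambda>\<omega>. t (S \<omega>)) D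
    \<le> cond_diff_entropy b M C D - cond_diff_entropy b M N1 N2"
proof -
  have Cm[measurable]: "C \<in> borel_measurable M"
    by (subst measurable_cong[OF C]) simp_all
  have Dm[measurable]: "D \<in> borel_measurable M"
    by (subst measurable_cong[OF D]) simp_all
  have Tm[measurable]: "(\<lambda>\<omega>. t (S \<omega>)) \<in> M \<rightarrow>\<^sub>M count_space Q" by measurable
  let ?T = "\<lambda>\<omega>. t (S \<omega>)"
  have t_in: "t s \<in> Q" for s using measurable_space[OF t, of s] by simp
  obtain p q where p: "p \<in> borel_measurable (lborel \<Otimes>\<^sub>M lborel)" "q \<in> borel_measurable borel"
    "\<And>z. 0 \<le> p z" "\<And>y. 0 \<le> q y"
    "distributed M (lborel \<Otimes>\<^sub>M lborel) (\<lambda>\<omega>. (N1 \<omega>, N2 \<omega>)) (\<lambda>z. ennreal (p z))"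
    "distributed M lborel N2 (\<lambda>y. ennreal (q y))"
    "integrable M (\<lambda>\<omega>. log b (p (N1 \<omega>, N2 \<omega>) / q (N2 \<omega>)))"
    "cond_diff_entropy b M N1 N2 = - expectation (\<lambda>\<omega>. log b (p (N1 \<omega>, N2 \<omega>) / q (N2 \<omega>)))"
    using cond_diff_entropy_finiteD[OF N1 N2 finN] by blast
  obtain p' q' where p': "p' \<in> borel_measurable (lborel \<Otimes>\<^sub>M lborel)" "q' \<in> borel_measurable borel"
    "\<And>z. 0 \<le> p' z" "\<And>y. 0 \<le> q' y"
    "distributed M (lborel \<Otimes>\<^sub>M lborel) (\<lambda>\<omega>. (C \<omega>, D \<omega>)) (\<lambda>z. ennreal (p' z))"
    "distributed M lborel D (\<lambda>y. ennreal (q' y))"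
    "integrable M (\<lambda>\<omega>. log b (p' (C \<omega>, D \<omega>) / q' (D \<omega>)))"
    "cond_diff_entropy b M C D = - expectation (\<lambda>\<omega>. log b (p' (C \<omega>, D \<omega>) / q' (D \<omega>)))"
    using cond_diff_entropy_finiteD[OF Cm Dm finY] by blast
  note [measurable] = p(1,2) p'(1,2)
  obtain r where r: "\<And>a. r a \<in> borel_measurable K" "\<And>a x. 0 \<le> r a x" "\<And>a x. r a x \<le> 1"
    "\<And>a A. a \<in> Q \<Longrightarrow> A \<in> sets K \<Longrightarrow>
      (\<integral>\<^sup>+\<omega>. ennreal (r a (X \<omega>)) * indicator A (X \<omega>) \<partial>M) = emeasure M {\<omega> \<in> space M. ?T \<omega> = a \<and> X \<omega> \<in> A}"
    using posterior_exists[OF Q Tm X] by blast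
  obtain rM where rM: "\<And>a. rM a \<in> borel_measurable borel" "\<And>a x. 0 \<le> rM a x" "\<And>a x. rM a x \<le> 1"
    "\<And>a A. a \<in> Q \<Longrightarrow> A \<in> sets borel \<Longrightarrow>
      (\<integral>\<^sup>+\<omega>. ennreal (rM a (D \<omega>)) * indicator A (D \<omega>) \<partial>M) = emeasure M {\<omega> \<in> space M. ?T \<omega> = a \<and> D \<omega> \<in> A}"
    using posterior_exists[OF Q Tm Dm] by blast
  note [measurable] = r(1) rM(1)
  have I: "AE \<omega> in M. 0 < r (?T \<omega>) (X \<omega>)" "integrable M (\<lambda>\<omega>. log b (r (?T \<omega>) (X \<omega>)))"
    "mutual_information b (count_space Q) K ?T X
      = expectation (\<lambda>\<omega>. log b (r (?T \<omega>) (X \<omega>))) - expectation (\<lambda>\<omega>. log b (prob {\<omega>' \<in> space M. ?T \<omega>' = ?T \<omega>}))"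
    by (rule mutual_information_posterior[OF Q Tm X r(1-3)]; erule (1) r(4))+
  have IM: "AE \<omega> in M. 0 < rM (?T \<omega>) (D \<omega>)" "integrable M (\<lambda>\<omega>. log b (rM (?T \<omega>) (D \<omega>)))"
    "mutual_information b (count_space Q) borel ?T D
      = expectation (\<lambda>\<omega>. log b (rM (?T \<omega>) (D \<omega>))) - expectation (\<lambda>\<omega>. log b (prob {\<omega>' \<in> space M. ?T \<omega>' = ?T \<omega>}))"
    by (rule mutual_information_posterior[OF Q Tm Dm rM(1-3)]; erule (1) rM(4))+
  \<comment> \<open>\<open>?h a\<close> is the density of \<open>(C, D)\<close> on the event
    \<open>?T \<omega> = a\<close> and \<open>?k a\<close> that of \<open>D\<close>;
    \<open>hk\<close> states that the second is the marginal of the first.\<close>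
  let ?h = "\<lambda>a z. r a (\<psi> z) * p' z" and ?k = "\<lambda>a y. rM a y * q' y"
  define U where "U \<omega> = (\<lambda>(s, n). ?h (t s) (s1 s + fst n, s2 s + snd n) * q (snd n) / (?k (t s) (s2 s + snd n) * p n)) (S \<omega>, (N1 \<omega>, N2 \<omega>))" for \<omega>
  have hk: "AE y in lborel. (\<integral>\<^sup>+x. ennreal (?h a (x, y)) \<partial>lborel) = ennreal (?k a y)" if "a \<in> Q" for a
    by (rule posterior_marginal[where a=a and r=r and rM=rM and p=p' and q=q' and C=C and D=D and X=X and g=g and \<psi>=\<psi>
        and T="\<lambda>\<omega>. t (S \<omega>)" and K=K, OF Cm Dm X g gX \<psi> X\<psi> p'(5,3,6,4) r(1,2) rM(1,2) r(4)[OF that] rM(4)[OF that]])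
  have U[measurable]: "U \<in> borel_measurable M" and U_le: "(\<integral>\<^sup>+\<omega>. ennreal (U \<omega>) \<partial>M) \<le> 1"
    unfolding U_def
    by (rule density_ratio_le_1[OF S law s Q t p(5,3,6,4) _ _ _ _ hk]; (simp add: r(2) rM(2) p'(3,4); fail | measurable))+
  have U_nn: "0 \<le> U \<omega>" for \<omega>
    using r(2) rM(2) p(3,4) p'(3,4) by (simp add: U_def)
  have U_int: "integrable M U"
    using U_le by (intro integrableI_nonneg) (auto simp: U_nn intro: order_le_less_trans)
  have U_exp: "expectation U \<le> 1"
    using U_le by (simp add: nn_integral_eq_integral[OF U_int] U_nn)
  let ?f = "\<lambda>\<omega>. log b (r (?T \<omega>) (X \<omega>)) - log b (rM (?T \<omega>) (D \<omega>))
    - (log b (p (N1 \<omega>, N2 \<omega>) / q (N2 \<omega>)) - log b (p' (C \<omega>, D \<omega>) / q' (D \<omega>)))"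
  have f_le: "AE \<omega> in M. ?f \<omega> \<le> (U \<omega> - 1) / ln b"
    using I(1) IM(1) distributed_AE_pos[OF p(5)] distributed_AE_pos[OF p(6)] distributed_AE_pos[OF p'(5)]
      distributed_AE_pos[OF p'(6)] AE_space
  proof eventually_elim
    case (elim \<omega>)
    \<comment> \<open>At the sample point the shifted noise is \<open>(C, D)\<close>, and
      \<open>\<psi>\<close> returns \<open>X\<close>. So \<open>U\<close> is built from two
      posteriors and two conditional densities, and its logarithm splits into the four terms of
      \<open>?f\<close>.\<close>
    have "U \<omega> = r (?T \<omega>) (X \<omega>) / rM (?T \<omega>) (D \<omega>) / ((p (N1 \<omega>, N2 \<omega>) / q (N2 \<omega>)) / (p' (C \<omega>, D \<omega>) / q' (D \<omega>)))"
      using elim by (simp add: U_def C[symmetric] D[symmetric] X\<psi>[symmetric] mult_ac)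
    then have "?f \<omega> = log b (U \<omega>)" and pos: "0 < U \<omega>"
      using elim by (simp_all add: log_divide log_mult)
    moreover have "log b (U \<omega>) \<le> (U \<omega> - 1) / ln b"
      using ln_le_minus_one[OF pos] b_gt_1 by (simp add: log_def divide_right_mono)
    ultimately show ?case by simp
  qed
  have "expectation ?f \<le> expectation (\<lambda>\<omega>. (U \<omega> - 1) / ln b)"
    by (rule integral_mono_AE[OF _ _ f_le]) (intro Bochner_Integration.integrable_diff I(2) IM(2) p(7) p'(7), use U_int in simp)
  also have "\<dots> = (expectation U - 1) / ln b"
    using U_int by (simp add: prob_space)
  also have "\<dots> \<le> 0" using U_exp b_gt_1 by (simp add: divide_nonpos_pos)
  finally have "expectation ?f \<le> 0" .
  also have "expectation ?f = expectation (\<lambda>\<omega>. log b (r (?T \<omega>) (X \<omega>))) - expectation (\<lambda>\<omega>. log b (rM (?T \<omega>) (D \<omega>)))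
    - (expectation (\<lambda>\<omega>. log b (p (N1 \<omega>, N2 \<omega>) / q (N2 \<omega>))) - expectation (\<lambda>\<omega>. log b (p' (C \<omega>, D \<omega>) / q' (D \<omega>))))"
    using I(2) IM(2) p(7) p'(7) by (simp only: Bochner_Integration.integral_diff Bochner_Integration.integrable_diff)
  finally show ?thesis
    unfolding I(3) IM(3) p(8) p'(8) by linarith
qed

text \<open>The bound for a single quantization does not depend on \<open>Q\<close>, so it passes to
  the supremum. Orthogonality of \<open>W\<close> supplies the inverse of the coordinate
  change.\<close>

lemma relevant_loss_le_entropy_difference:
  fixes S N X :: "'a \<Rightarrow> real ^ ('m::finite + 'c::finite)" and W :: "real ^ ('m + 'c) ^ ('m + 'c)"
  assumes "prob_space P" and b: "1 < b"
    and indep: "prob_space.indep_var P borel S borel N"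
    and X: "\<And>\<omega>. \<omega> \<in> space P \<Longrightarrow> X \<omega> = S \<omega> + N \<omega>"
    and W: "orthogonal_matrix W"
    and finX: "cond_diff_entropy_finite b P (\<lambda>\<omega>. tail_coords W (X \<omega>)) (\<lambda>\<omega>. head_coords W (X \<omega>))"
    and finN: "cond_diff_entropy_finite b P (\<lambda>\<omega>. tail_coords W (N \<omega>)) (\<lambda>\<omega>. head_coords W (N \<omega>))"
  shows "relevant_loss b P S X (head_coords W)
    \<le> ereal (cond_diff_entropy b P (\<lambda>\<omega>. tail_coords W (X \<omega>)) (\<lambda>\<omega>. head_coords W (X \<omega>))
      - cond_diff_entropy b P (\<lambda>\<omega>. tail_coords W (N \<omega>)) (\<lambda>\<omega>. head_coords W (N \<omega>)))"
proof -
  interpret prob_space P by fact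
  interpret information_space P b by unfold_locales (fact b)
  have S[measurable]: "S \<in> borel_measurable P" and N[measurable]: "N \<in> borel_measurable P"
    using indep by (auto simp: indep_var_distribution_eq)
  have Xm[measurable]: "X \<in> borel_measurable P"
    by (subst measurable_cong[OF X]) simp_all
  let ?L = "lborel \<Otimes>\<^sub>M lborel :: ((real^'c) \<times> (real^'m)) measure"
  let ?\<phi> = "\<lambda>x. (tail_coords W x, head_coords W x)"
  have \<phi>[measurable]: "?\<phi> \<in> borel \<rightarrow>\<^sub>M ?L" by measurable
  \<comment> \<open>Independence of \<open>S\<close> and \<open>N\<close> as a product law, pushed
    through the coordinate map applied to the noise alone.\<close>
  have law: "distr P (borel \<Otimes>\<^sub>M ?L) (\<lambda>\<omega>. (S \<omega>, ?\<phi> (N \<omega>))) = distr P borel S \<Otimes>\<^sub>M distr P ?L (\<lambda>\<omega>. ?\<phi> (N \<omega>))"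
  proof -
    interpret PN: prob_space "distr P ?L (\<lambda>\<omega>. ?\<phi> (N \<omega>))" by (rule prob_space_distr) measurable
    have eq: "distr (distr P borel N) ?L ?\<phi> = distr P ?L (\<lambda>\<omega>. ?\<phi> (N \<omega>))"
      by (subst distr_distr) (simp_all add: o_def)
    have "distr P borel S \<Otimes>\<^sub>M distr (distr P borel N) ?L ?\<phi>
        = distr (distr P borel S) borel (\<lambda>x. x) \<Otimes>\<^sub>M distr (distr P borel N) ?L ?\<phi>"
      by (simp add: distr_id2)
    also have "\<dots> = distr (distr P borel S \<Otimes>\<^sub>M distr P borel N) (borel \<Otimes>\<^sub>M ?L) (\<lambda>(x, y). (x, ?\<phi> y))"
      by (rule pair_measure_distr) (simp_all add: eq PN.sigma_finite_measure_axioms)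
    also have "distr P borel S \<Otimes>\<^sub>M distr P borel N = distr P (borel \<Otimes>\<^sub>M borel) (\<lambda>\<omega>. (S \<omega>, N \<omega>))"
      using indep by (simp add: indep_var_distribution_eq)
    also have "distr \<dots> (borel \<Otimes>\<^sub>M ?L) (\<lambda>(x, y). (x, ?\<phi> y)) = distr P (borel \<Otimes>\<^sub>M ?L) (\<lambda>\<omega>. (S \<omega>, ?\<phi> (N \<omega>)))"
      by (subst distr_distr) (simp_all add: o_def)
    finally show ?thesis by (simp add: eq)
  qed
  have WW: "W *v (transpose W *v x) = x" for x
    using W by (simp add: matrix_vector_mul_assoc orthogonal_matrix_def)
  show ?thesis
    unfolding relevant_loss_def
  proof (rule SUP_least)
    fix Q :: "(real^('m + 'c)) set set"
    assume "Q \<in> {Q. finite Q \<and> Q \<subseteq> sets borel \<and> partition_on UNIV Q}"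
    then have Q: "finite Q" "quantize Q \<in> borel \<rightarrow>\<^sub>M count_space Q"
      using measurable_quantize by auto
    have "mutual_information b (count_space Q) borel (\<lambda>\<omega>. quantize Q (S \<omega>)) X
        - mutual_information b (count_space Q) borel (\<lambda>\<omega>. quantize Q (S \<omega>)) (\<lambda>\<omega>. head_coords W (X \<omega>))
      \<le> cond_diff_entropy b P (\<lambda>\<omega>. tail_coords W (X \<omega>)) (\<lambda>\<omega>. head_coords W (X \<omega>))
      - cond_diff_entropy b P (\<lambda>\<omega>. tail_coords W (N \<omega>)) (\<lambda>\<omega>. head_coords W (N \<omega>))"
    proof (rule mutual_information_loss_le[where ?s1.0="tail_coords W" and ?s2.0="head_coords W" and g="head_coords W"
          and \<psi>="\<lambda>z. W *v join_blocks (snd z) (fst z)", OF S _ _ law _ _ _ _ finN finX Xm _ _ _ _ Q])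
      show "tail_coords W (X \<omega>) = tail_coords W (S \<omega>) + tail_coords W (N \<omega>)"
        "head_coords W (X \<omega>) = head_coords W (S \<omega>) + head_coords W (N \<omega>)" if "\<omega> \<in> space P" for \<omega>
        by (simp_all add: X[OF that] matrix_vector_right_distrib linear_add[OF linear_first_block] linear_add[OF linear_last_block])
      show "(\<lambda>z. W *v join_blocks (snd z) (fst z)) \<in> ?L \<rightarrow>\<^sub>M borel"
        by (intro borel_measurable_matrix_vector_mult measurable_join_blocks) auto
      show "X \<omega> = W *v join_blocks (snd (?\<phi> (X \<omega>))) (fst (?\<phi> (X \<omega>)))" for \<omega>
        by (simp add: WW)
      show "(\<lambda>\<omega>. tail_coords W (N \<omega>)) \<in> borel_measurable P" "(\<lambda>\<omega>. head_coords W (N \<omega>)) \<in> borel_measurable P"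
        "tail_coords W \<in> borel_measurable borel" "head_coords W \<in> borel_measurable borel"
        "head_coords W \<in> borel_measurable borel"
        by measurable
    qed (rule refl)
    then show "ereal (mutual_information b (count_space Q) borel (\<lambda>\<omega>. quantize Q (S \<omega>)) X
        - mutual_information b (count_space Q) borel (\<lambda>\<omega>. quantize Q (S \<omega>)) (\<lambda>\<omega>. head_coords W (X \<omega>)))
      \<le> ereal (cond_diff_entropy b P (\<lambda>\<omega>. tail_coords W (X \<omega>)) (\<lambda>\<omega>. head_coords W (X \<omega>))
      - cond_diff_entropy b P (\<lambda>\<omega>. tail_coords W (N \<omega>)) (\<lambda>\<omega>. head_coords W (N \<omega>)))"
      by (simp only: ereal_less_eq)
  qed
qed

theorem theorem1:
  fixes P :: "'a measure" and b :: real
    and S N X :: "'a \<Rightarrow> real ^ ('m::{finite,linorder} + 'c::{finite,linorder})"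
    and W :: "real ^ ('m + 'c) ^ ('m + 'c)"
  assumes "prob_space P" and "1 < b"
    and indep: "prob_space.indep_var P borel S borel N"
    and X: "\<And>\<omega>. \<omega> \<in> space P \<Longrightarrow> X \<omega> = S \<omega> + N \<omega>"
    and "integrable P (\<lambda>\<omega>. (norm (S \<omega>))\<^sup>2)"
    and "integrable P (\<lambda>\<omega>. (norm (N \<omega>))\<^sup>2)"
    and pca: "pca_matrix (cov_matrix P X) W"
    and iid: "\<exists>\<sigma>2. cov_matrix P N = \<sigma>2 *\<^sub>R mat 1"
    and "cond_diff_entropy_finite b P (\<lambda>\<omega>. tail_coords W (X \<omega>)) (\<lambda>\<omega>. head_coords W (X \<omega>))"
    and "cond_diff_entropy_finite b P (\<lambda>\<omega>. tail_coords W (N \<omega>)) (\<lambda>\<omega>. head_coords W (N \<omega>))"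
    and more_gaussian:
      "cond_divergence b P (\<lambda>\<omega>. tail_coords W (N \<omega>)) (\<lambda>\<omega>. head_coords W (N \<omega>))
       \<le> cond_divergence b P (\<lambda>\<omega>. tail_coords W (X \<omega>)) (\<lambda>\<omega>. head_coords W (X \<omega>))"
  shows "relevant_loss b P S X (head_coords W) \<le> ereal (gaussian_bound b P X N W)
    \<and> (\<forall>V. invertible V \<longrightarrow> gaussian_bound b P X N W \<le> gaussian_bound b P X N V)"
proof (intro conjI allI impI)
  interpret prob_space P by fact
  have S[measurable]: "S \<in> borel_measurable P" and N[measurable]: "N \<in> borel_measurable P"
    using indep by (auto simp: indep_var_distribution_eq)
  have Xm[measurable]: "X \<in> borel_measurable P"
    by (subst measurable_cong[OF X]) simp_all
  have sqX: "integrable P (\<lambda>\<omega>. (norm (X \<omega>))\<^sup>2)"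
  proof (rule Bochner_Integration.integrable_bound)
    show "integrable P (\<lambda>\<omega>. 2 * (norm (S \<omega>))\<^sup>2 + 2 * (norm (N \<omega>))\<^sup>2)"
      using assms(5,6) by simp
    show "AE \<omega> in P. norm ((norm (X \<omega>))\<^sup>2) \<le> norm (2 * (norm (S \<omega>))\<^sup>2 + 2 * (norm (N \<omega>))\<^sup>2)"
    proof (rule AE_I2)
      fix \<omega> assume "\<omega> \<in> space P"
      then have "(norm (X \<omega>))\<^sup>2 \<le> (norm (S \<omega>) + norm (N \<omega>))\<^sup>2"
        by (auto simp: X intro!: power_mono norm_triangle_ineq)
      also have "\<dots> \<le> 2 * (norm (S \<omega>))\<^sup>2 + 2 * (norm (N \<omega>))\<^sup>2"
        using sum_squares_bound[of "norm (S \<omega>)" "norm (N \<omega>)"] by (simp add: power2_sum)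
      finally show "norm ((norm (X \<omega>))\<^sup>2) \<le> norm (2 * (norm (S \<omega>))\<^sup>2 + 2 * (norm (N \<omega>))\<^sup>2)" by simp
    qed
  qed measurable
  obtain lam where W: "orthogonal_matrix W"
    and lam: "\<And>i. cov_matrix P X *v column i W = lam i *\<^sub>R column i W"
    and ord: "\<And>i j. coord_le i j \<Longrightarrow> lam j \<le> lam i"
    using pca by (auto simp: pca_matrix_def rotation_matrix_def)
  obtain \<sigma>2 where \<sigma>2: "cov_matrix P N = \<sigma>2 *\<^sub>R mat 1" using iid by blast
  have "relevant_loss b P S X (head_coords W)
    \<le> ereal (cond_diff_entropy b P (\<lambda>\<omega>. tail_coords W (X \<omega>)) (\<lambda>\<omega>. head_coords W (X \<omega>))
      - cond_diff_entropy b P (\<lambda>\<omega>. tail_coords W (N \<omega>)) (\<lambda>\<omega>. head_coords W (N \<omega>)))"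
    by (rule relevant_loss_le_entropy_difference[OF assms(1,2) indep X W assms(9,10)])
  \<comment> \<open>With each entropy written as its Gaussian counterpart minus the divergence, the
    surplus over the Gaussian bound is the noise divergence minus the signal divergence, which
    \<open>more_gaussian\<close> makes nonpositive.\<close>
  also have "\<dots> \<le> ereal (gaussian_bound b P X N W)"
    using more_gaussian by (simp add: gaussian_bound_def cond_divergence_def)
  finally show "relevant_loss b P S X (head_coords W) \<le> ereal (gaussian_bound b P X N W)" .
  fix V :: "real ^ ('m + 'c) ^ ('m + 'c)" assume V: "invertible V"
  show "gaussian_bound b P X N W \<le> gaussian_bound b P X N V"
    by (rule eigenbasis_minimizes_gaussian_bound[OF assms(1,2) Xm sqX N assms(6) W lam _ \<sigma>2 _ _ V])
      (use ord assms(9,10) in \<open>auto simp: cond_diff_entropy_finite_def\<close>)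
qed

end
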